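(* Let $L\in\{1,\infty\}$, $0<p,r,q\le\infty$, $a,b\in SV(0,L)$ be such that the space $L^{\mathcal L}_{p,r,b,q,a}=L^{\mathcal L}_{p,r,b,q,a}(0,L)$ is non-trivial (i.e. $\neq\{0\}$). Let $d\in SV(0,L)$, $0<U<\infty$, $0<V\le\infty$, $0<W\le\infty$. (i) If $0<U<p$, then for all $f\in\mathfrak M(0,L)$ $$\|f\|_{L^{\mathcal L}_{p,r,b,q,a}}\sim\big\|H^{(U,W;d)}f\big\|_{B^{\mathcal L}_{p,r,b,q,a}} .$$ (ii) If $p<V\le\infty$, then for all $f\in\mathfrak M(0,L)$ $$\|f\|_{L^{\mathcal L}_{p,r,b,q,a}}\sim\big\|H_{(V,W;d)}f\big\|_{B^{\mathcal L}_{p,r,b,q,a}} .$$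
   Context: Conventions: $1/\infty=0$. $\mathfrak M(0,L)$ is the set of complex-valued Lebesgue measurable a.e. finite functions on $(0,L)$ (identified if equal a.e.). For $0<q\le\infty$, $\|\cdot\|_{q,(a,b)}$ is the usual Lebesgue (quasi-)norm on the interval $(a,b)$ (essential supremum if $q=\infty$). $f^*(t)=\inf\{\lambda>0:\ |\{x\in(0,L):|f(x)|>\lambda\}|\le t\}$ is the non-increasing rearrangement. $F\sim G$ means $c\,G\le F\le C\,G$ with constants $0<c\le C<\infty$ independent of $f$ (both sides may be $\infty$). $SV=SV(0,L)$: positive measurable $d$ on $(0,L)$ such that for every $\varepsilon>0$ the function $t^{\varepsilon}d(t)$ is equivalent ($\sim$, pointwise with constants) to a non-decreasing function and $t^{-\varepsilon}d(t)$ is equivalent to a non-increasing function. For measurable $g$ on $(0,L)$ (possibly with value $\infty$), $$\|g\|_{B^{\mathcal L}_{p,r,b,q,a}}=\Big\|t^{-\frac1r}b(t)\big\|u^{\frac1p-\frac1q}a(u)|g(u)|\big\|_{q,(0,t)}\Big\|_{r,(0,L)},$$ and $L^{\mathcal L}_{p,r,b,q,a}$ is the set of $f\in\mathfrak M(0,L)$ with $\|f\|_{L^{\mathcal L}_{p,r,b,q,a}}:=\|f^*\|_{B^{\mathcal L}_{p,r,b,q,a}}<\infty$. Averaging operators, for $f\in\mathfrak M(0,L)$, $t\in(0,L)$: $$(H^{(U,W;d)}f)(t)=\big(t^{1/U}d(t)\big)^{-1}\big\|v^{\frac1U-\frac1W}d(v)f^*(v)\big\|_{W,(0,t)},$$ $$(H_{(V,W;d)}f)(t)=\big(t^{1/V}d(t)\big)^{-1}\big\|v^{\frac1V-\frac1W}d(v)f^*(v)\big\|_{W,(t,L)}.$$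 *)

theory Defs
  imports "HOL-Analysis.Analysis" "HOL-Probability.Essential_Supremum"
begin

text \<open>
  Exponents and end points are extended reals; \<open>1 / \<infinity> = 0\<close> holds for \<^typ>\<open>ereal\<close>, so the
  real number \<open>1/p\<close> is \<open>real_of_ereal (1 / p)\<close>. All norms take values in \<^typ>\<open>ennreal\<close>,
  with \<open>\<infinity>\<close> allowed. The interval \<open>(a, b)\<close> is \<^term>\<open>einterval a b\<close>.
\<close>

abbreviation recip :: "ereal \<Rightarrow> real" where
  "recip p \<equiv> real_of_ereal (1 / p)"

text \<open>Only used with a positive exponent, whence \<open>\<infinity>\<close> is mapped to \<open>\<infinity>\<close>.\<close>

definition epowr :: "ennreal \<Rightarrow> real \<Rightarrow> ennreal" where
  "epowr x s = (if x = \<infinity> then \<infinity> else ennreal (enn2real x powr s))"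

definition lebesgue_norm :: "ereal \<Rightarrow> ereal \<Rightarrow> ereal \<Rightarrow> (real \<Rightarrow> ennreal) \<Rightarrow> ennreal" where
  "lebesgue_norm q a b g =
     (if q = \<infinity> then esssup (lebesgue_on (einterval a b)) g
      else epowr (\<integral>\<^sup>+x. epowr (g x) (real_of_ereal q) \<partial>lebesgue_on (einterval a b)) (recip q))"

text \<open>
  An almost everywhere finite function is represented by one that is finite everywhere,
  which agrees with it almost everywhere.
\<close>

definition measurable_funs :: "ereal \<Rightarrow> (real \<Rightarrow> complex) set" where
  "measurable_funs L = borel_measurable (lebesgue_on (einterval 0 L))"

text \<open>The value is \<open>\<infinity>\<close> if no \<open>l\<close> qualifies, which can happen for \<open>L = \<infinity>\<close>.\<close>

definition rearrangement :: "ereal \<Rightarrow> (real \<Rightarrow> complex) \<Rightarrow> real \<Rightarrow> ennreal" where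
  "rearrangement L f t =
     Inf {ennreal l | l. 0 < l \<and> emeasure lebesgue {x \<in> einterval 0 L. cmod (f x) > l} \<le> ennreal t}"

definition equivalent_on :: "'a set \<Rightarrow> ('a \<Rightarrow> ennreal) \<Rightarrow> ('a \<Rightarrow> ennreal) \<Rightarrow> bool" where
  "equivalent_on S F G \<longleftrightarrow>
     (\<exists>c C :: real. 0 < c \<and> c \<le> C \<and> (\<forall>x\<in>S. ennreal c * G x \<le> F x \<and> F x \<le> ennreal C * G x))"

text \<open>
  In the two monotonicity conditions the equivalence forces the comparison functions to be
  positive and finite on \<open>(0, L)\<close>.
\<close>

definition SV :: "ereal \<Rightarrow> (real \<Rightarrow> real) set" where
  "SV L = {d. d \<in> borel_measurable (lebesgue_on (einterval 0 L)) \<and> (\<forall>t\<in>einterval 0 L. 0 < d t) \<and>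
     (\<forall>\<epsilon>>0.
       (\<exists>g. mono_on (einterval 0 L) g \<and>
          equivalent_on (einterval 0 L) (\<lambda>t. ennreal (t powr \<epsilon> * d t)) g) \<and>
       (\<exists>g. antimono_on (einterval 0 L) g \<and>
          equivalent_on (einterval 0 L) (\<lambda>t. ennreal (t powr (- \<epsilon>) * d t)) g))}"

definition B_norm ::
  "ereal \<Rightarrow> ereal \<Rightarrow> ereal \<Rightarrow> (real \<Rightarrow> real) \<Rightarrow> ereal \<Rightarrow> (real \<Rightarrow> real) \<Rightarrow> (real \<Rightarrow> ennreal) \<Rightarrow> ennreal" where
  "B_norm L p r b q a g =
     lebesgue_norm r 0 L (\<lambda>t. ennreal (t powr (- recip r) * b t) *
       lebesgue_norm q 0 (ereal t) (\<lambda>u. ennreal (u powr (recip p - recip q) * a u) * g u))"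

definition L_norm ::
  "ereal \<Rightarrow> ereal \<Rightarrow> ereal \<Rightarrow> (real \<Rightarrow> real) \<Rightarrow> ereal \<Rightarrow> (real \<Rightarrow> real) \<Rightarrow> (real \<Rightarrow> complex) \<Rightarrow> ennreal" where
  "L_norm L p r b q a f = B_norm L p r b q a (rearrangement L f)"

definition L_space ::
  "ereal \<Rightarrow> ereal \<Rightarrow> ereal \<Rightarrow> (real \<Rightarrow> real) \<Rightarrow> ereal \<Rightarrow> (real \<Rightarrow> real) \<Rightarrow> (real \<Rightarrow> complex) set" where
  "L_space L p r b q a = {f \<in> measurable_funs L. L_norm L p r b q a f < \<infinity>}"

text \<open>
  Functions are not quotiented by equality almost everywhere, so a set of functions is
  different from \<open>{0}\<close> if it has a member that does not vanish almost everywhere.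
\<close>

definition nontrivial_space :: "ereal \<Rightarrow> (real \<Rightarrow> complex) set \<Rightarrow> bool" where
  "nontrivial_space L X \<longleftrightarrow> (\<exists>f\<in>X. \<not> (AE x in lebesgue_on (einterval 0 L). f x = 0))"

definition H_lower ::
  "ereal \<Rightarrow> ereal \<Rightarrow> ereal \<Rightarrow> (real \<Rightarrow> real) \<Rightarrow> (real \<Rightarrow> complex) \<Rightarrow> real \<Rightarrow> ennreal" where
  "H_lower L U W d f t =
     inverse (ennreal (t powr recip U * d t)) *
     lebesgue_norm W 0 (ereal t)
       (\<lambda>v. ennreal (v powr (recip U - recip W) * d v) * rearrangement L f v)"

definition H_upper ::
  "ereal \<Rightarrow> ereal \<Rightarrow> ereal \<Rightarrow> (real \<Rightarrow> real) \<Rightarrow> (real \<Rightarrow> complex) \<Rightarrow> real \<Rightarrow> ennreal" where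
  "H_upper L V W d f t =
     inverse (ennreal (t powr recip V * d t)) *
     lebesgue_norm W (ereal t) L
       (\<lambda>v. ennreal (v powr (recip V - recip W) * d v) * rearrangement L f v)"

end

theory Submission
  imports Defs
begin

text \<open>
  All norms are rewritten with respect to the measure \<open>du/u\<close>, with weights \<open>u powr \<rho>\<close> times
  a slowly varying function. Let \<open>f*\<close> be non-increasing and \<open>\<phi>\<close> such a weight. Up to constants,
  \<open>\<phi>(t) f*(t)\<close> is at most the \<open>L\<^sup>q(du/u)\<close>-norm of \<open>\<phi> f*\<close> over \<open>(t/2, t)\<close>, for every \<open>q\<close>. Hence the exponent
  \<open>W\<close> of the averaging operator can be exchanged for \<open>q\<close> at the price of an arbitrarily small
  power of \<open>u\<close>, and what remains is Hardy's inequality with equal exponents, which for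
  every \<open>q > 0\<close> is Tonelli's theorem. The averages over \<open>(0, t)\<close> are bounded by this for each \<open>t\<close> of the
  outer norm separately. For the averages over \<open>(u, L)\<close> with \<open>u < t\<close> the interval is cut
  at \<open>t\<close>; the contribution of \<open>(t, L)\<close> is bounded by a second Hardy inequality, in the outer norm.
\<close>

section \<open>Powers and monotone functions with values in ennreal\<close>

text \<open>The exponents \<open>W\<close>, \<open>q\<close>, \<open>r\<close> are unrelated and may
  lie below 1, so Minkowski, Hoelder and duality are out of reach. What pays for the exchange of
  exponents is the strict inequality between \<open>p\<close> and \<open>U\<close> or
  \<open>V\<close>: with \<open>\<phi>\<close> and \<open>\<psi>\<close> the weights of the norm and
  of the average, the index of \<open>\<phi> / \<psi>\<close> is \<open>- 4 * e\<close> or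
  \<open>4 * e\<close> with \<open>e > 0\<close>. Of these four parts one is lost in the bounds for
  slowly varying factors, two make the \<open>W\<close>-norm of a power finite, and one drives
  Hardy's inequality. The second Hardy inequality, in the outer norm, is available because
  \<open>b\<close> is slowly varying: \<open>b * \<phi>\<close> has the index of
  \<open>\<phi>\<close>. The opposite estimates need a dyadic interval to the left of the point
  inside the range of averaging. For \<open>(0, t)\<close> this is \<open>(t/2, t)\<close>. The
  range \<open>(v, L)\<close> contains no such interval for \<open>v\<close>, but it contains one
  for \<open>2 * v\<close>, and the resulting dilation has to be removed under the norm.\<close>

lemma epowr_ennreal: "0 \<le> x \<Longrightarrow> epowr (ennreal x) s = ennreal (x powr s)"
  by (simp add: epowr_def)

lemma epowr_top [simp]: "epowr \<infinity> s = \<infinity>" "epowr top s = top"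
  by (simp_all add: epowr_def)

lemma epowr_0 [simp]: "epowr 0 s = 0"
  by (simp add: epowr_def)

lemma epowr_measurable [measurable]: "(\<lambda>x. epowr x s) \<in> borel_measurable borel"
  unfolding epowr_def by measurable

lemma epowr_mono: "x \<le> y \<Longrightarrow> 0 \<le> s \<Longrightarrow> epowr x s \<le> epowr y s"
  by (cases x rule: ennreal_cases; cases y rule: ennreal_cases)
     (auto simp: epowr_ennreal top_unique intro: ennreal_leI powr_mono2)

lemma epowr_mult: "0 < s \<Longrightarrow> epowr (x * y) s = epowr x s * epowr y s"
proof (cases x rule: ennreal_cases; cases y rule: ennreal_cases)
  fix a b :: real
  assume "0 \<le> a" "x = ennreal a" "0 \<le> b" "y = ennreal b"
  then show ?thesis
    by (simp add: epowr_ennreal powr_mult flip: ennreal_mult)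
next
  fix a :: real
  assume "0 < s" "0 \<le> a" "x = ennreal a" "y = top"
  then show ?thesis
    by (cases "a = 0") (auto simp: epowr_ennreal ennreal_mult_top)
next
  fix a :: real
  assume "0 < s" "0 \<le> a" "x = top" "y = ennreal a"
  then show ?thesis
    by (cases "a = 0") (auto simp: epowr_ennreal ennreal_top_mult)
qed auto

lemma epowr_inverse_right: "0 < s \<Longrightarrow> epowr (epowr x s) (1 / s) = x"
  by (cases x rule: ennreal_cases) (auto simp: epowr_ennreal powr_powr)

lemma epowr_inverse_left: "0 < s \<Longrightarrow> epowr (epowr x (1 / s)) s = x"
  by (cases x rule: ennreal_cases) (auto simp: epowr_ennreal powr_powr)

text \<open>Twice the maximum bounds the sum, and the maximum is one of the two summands. This
  treats \<open>s < 1\<close> and \<open>s \<ge> 1\<close> alike.\<close>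

lemma epowr_add_le:
  assumes "0 < s" shows "epowr (x + y) s \<le> ennreal (2 powr s) * (epowr x s + epowr y s)"
proof -
  have "x + y \<le> 2 * max x y"
    by (metis add_mono max.cobounded1 max.cobounded2 mult_2)
  then have "epowr (x + y) s \<le> epowr (ennreal 2 * max x y) s"
    using assms by (intro epowr_mono) auto
  also have "\<dots> = ennreal (2 powr s) * epowr (max x y) s"
    using assms by (simp only: epowr_mult epowr_ennreal)
  also have "epowr (max x y) s \<le> epowr x s + epowr y s"
    by (simp add: max_def)
  finally show ?thesis by (simp add: mult_left_mono)
qed

text \<open>Superlevel sets of monotone functions are intervals. With the increasing counterpart
  this gives measurability of non-increasing functions and of norms regarded as functions of an end
  point of their interval.\<close>

lemma antimono_ennreal_measurable:
  fixes g :: "real \<Rightarrow> ennreal"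
  assumes "antimono g"
  shows "g \<in> borel_measurable borel"
proof (rule borel_measurableI_greater)
  fix y
  have "is_interval {x. y < g x}"
    using assms unfolding is_interval_1 antimono_def by (auto intro: less_le_trans)
  then show "{x \<in> space borel. y < g x} \<in> sets borel"
    by (simp add: real_interval_borel_measurable)
qed

lemma mono_ennreal_measurable:
  fixes g :: "real \<Rightarrow> ennreal"
  assumes "mono g"
  shows "g \<in> borel_measurable borel"
proof (rule borel_measurableI_greater)
  fix y
  have "is_interval {x. y < g x}"
    using assms unfolding is_interval_1 mono_def by (auto intro: less_le_trans)
  then show "{x \<in> space borel. y < g x} \<in> sets borel"
    by (simp add: real_interval_borel_measurable)
qed

lemma ident_lebesgue_on [measurable]: "(\<lambda>x::real. x) \<in> borel_measurable (lebesgue_on S)"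
  by (intro measurable_restrict_space1 measurable_completion) simp

lemma ident_lebesgue [measurable]: "(\<lambda>x::real. x) \<in> borel_measurable lebesgue"
  by (intro measurable_completion) simp

lemma borel_imp_lebesgue_on:
  fixes f :: "real \<Rightarrow> 'a::topological_space"
  shows "f \<in> borel_measurable borel \<Longrightarrow> f \<in> borel_measurable (lebesgue_on S)"
  by (intro measurable_restrict_space1 measurable_completion) simp

section \<open>The norm with respect to \<open>du/u\<close>\<close>

text \<open>Raised to the power \<open>q\<close>, the extra factor turns \<open>du\<close> into
  \<open>du/u\<close>; for \<open>q = \<infinity>\<close> it is 1 on positive \<open>u\<close>. The
  measure is invariant under dilations, so constants become independent of the position of an
  interval, and the powers left in the weights no longer involve \<open>q\<close>, \<open>r\<close>
  or \<open>W\<close>.\<close>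

definition haar_norm :: "ereal \<Rightarrow> ereal \<Rightarrow> ereal \<Rightarrow> (real \<Rightarrow> ennreal) \<Rightarrow> ennreal" where
  "haar_norm q x y G = lebesgue_norm q x y (\<lambda>u. ennreal (u powr - recip q) * G u)"

lemma einterval_pos: "0 \<le> x \<Longrightarrow> u \<in> einterval x y \<Longrightarrow> 0 < u"
  by (metis einterval_iff ereal_less(2) order_le_less_trans)

lemma recip_ereal: "recip (ereal s) = 1 / s"
  by (cases "s = 0") (auto simp: one_ereal_def)

text \<open>Since \<open>recip \<infinity> = 0\<close> and \<open>u powr 0\<close> is 1 only for
  \<open>u \<noteq> 0\<close>, the interval is kept to the right of 0.\<close>

lemma haar_norm_infinity:
  assumes "0 \<le> x" "G \<in> borel_measurable (lebesgue_on (einterval x y))"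
  shows "haar_norm \<infinity> x y G = esssup (lebesgue_on (einterval x y)) G"
proof -
  have "AE u in lebesgue_on (einterval x y). ennreal (u powr - recip \<infinity>) * G u = G u"
    using einterval_pos[OF assms(1)] by (intro AE_I2) fastforce
  then show ?thesis
    using assms(2) unfolding haar_norm_def lebesgue_norm_def
    by (simp, intro esssup_AE_cong) auto
qed

text \<open>Indicators in place of restricted measures put all intervals over one fixed measure, as
  additivity at a cut and Tonelli's theorem require.\<close>

lemma haar_norm_finite:
  assumes "0 \<le> x" "0 < s"
  shows "haar_norm (ereal s) x y G =
    epowr (\<integral>\<^sup>+u. ennreal (inverse u) * epowr (G u) s * indicator (einterval x y) u \<partial>lebesgue) (1 / s)"
proof -
  have "haar_norm (ereal s) x y G =
    epowr (\<integral>\<^sup>+u. epowr (ennreal (u powr - (1 / s)) * G u) s * indicator (einterval x y) u \<partial>lebesgue) (1 / s)"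
    unfolding haar_norm_def lebesgue_norm_def recip_ereal
    by (simp add: nn_integral_restrict_space)
  also have "(\<integral>\<^sup>+u. epowr (ennreal (u powr - (1 / s)) * G u) s * indicator (einterval x y) u \<partial>lebesgue)
     = (\<integral>\<^sup>+u. ennreal (inverse u) * epowr (G u) s * indicator (einterval x y) u \<partial>lebesgue)"
  proof (rule nn_integral_cong)
    fix u
    show "epowr (ennreal (u powr - (1 / s)) * G u) s * indicator (einterval x y) u
      = ennreal (inverse u) * epowr (G u) s * indicator (einterval x y) u"
    proof (cases "u \<in> einterval x y")
      case True
      then have "0 < u"
        using einterval_pos[OF assms(1)] by blast
      then have "(u powr - (1 / s)) powr s = inverse u"
        using assms(2) by (simp only: powr_powr) (simp add: powr_minus)
      then show ?thesis
        using assms(2) by (simp add: epowr_mult epowr_ennreal)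
    qed simp
  qed
  finally show ?thesis .
qed

lemma exponent_cases:
  fixes q :: ereal
  assumes "0 < q"
  obtains s where "0 < s" "q = ereal s" | "q = \<infinity>"
  using assms by (cases q) auto

section \<open>Monotonicity of the norm in the function and in the interval\<close>

lemma measurable_subinterval:
  "G \<in> borel_measurable (lebesgue_on A) \<Longrightarrow> B \<subseteq> A \<Longrightarrow> G \<in> borel_measurable (lebesgue_on B)"
  by (rule measurable_restrict_mono)

text \<open>The constant \<open>c\<close> is an element of \<open>ennreal\<close> and not a real
  number, because in the applications it may contain a norm that is infinite.\<close>

lemma haar_norm_le:
  assumes q: "0 < q" and x: "0 \<le> x"
    and G [measurable]: "G \<in> borel_measurable (lebesgue_on (einterval x y))"
    and G' [measurable]: "G' \<in> borel_measurable (lebesgue_on (einterval x y))"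
    and le: "\<And>u. u \<in> einterval x y \<Longrightarrow> G u \<le> c * G' u"
  shows "haar_norm q x y G \<le> c * haar_norm q x y G'"
  using q
proof (cases rule: exponent_cases)
  case (1 s)
  let ?I = "indicator (einterval x y) :: real \<Rightarrow> ennreal"
  have [measurable]: "(\<lambda>u. epowr (G' u) s * ?I u) \<in> borel_measurable lebesgue"
    by (subst borel_measurable_restrict_space_iff_ennreal[symmetric]) auto
  have "(\<integral>\<^sup>+u. ennreal (inverse u) * epowr (G u) s * ?I u \<partial>lebesgue)
      \<le> (\<integral>\<^sup>+u. epowr c s * (ennreal (inverse u) * (epowr (G' u) s * ?I u)) \<partial>lebesgue)"
  proof (rule nn_integral_mono)
    fix u
    show "ennreal (inverse u) * epowr (G u) s * ?I u \<le> epowr c s * (ennreal (inverse u) * (epowr (G' u) s * ?I u))"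
    proof (cases "u \<in> einterval x y")
      case True
      have "epowr (G u) s \<le> epowr c s * epowr (G' u) s"
        using epowr_mono[OF le[OF True], of s] 1 by (simp add: epowr_mult)
      then have "ennreal (inverse u) * epowr (G u) s \<le> ennreal (inverse u) * (epowr c s * epowr (G' u) s)"
        by (rule mult_left_mono) simp
      with True show ?thesis by (simp add: mult_ac)
    qed simp
  qed
  also have "\<dots> = epowr c s * (\<integral>\<^sup>+u. ennreal (inverse u) * (epowr (G' u) s * ?I u) \<partial>lebesgue)"
    by (rule nn_integral_cmult) measurable
  finally have "epowr (\<integral>\<^sup>+u. ennreal (inverse u) * epowr (G u) s * ?I u \<partial>lebesgue) (1 / s)
     \<le> epowr (epowr c s * (\<integral>\<^sup>+u. ennreal (inverse u) * (epowr (G' u) s * ?I u) \<partial>lebesgue)) (1 / s)"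
    using 1 by (intro epowr_mono) auto
  then show ?thesis
    using 1 x by (simp add: haar_norm_finite epowr_mult epowr_inverse_right mult.assoc)
next
  case 2
  have "AE u in lebesgue_on (einterval x y). G u \<le> c * esssup (lebesgue_on (einterval x y)) G'"
    using esssup_AE[where M = "lebesgue_on (einterval x y)" and f = G'] AE_space
  proof eventually_elim
    case (elim u)
    then have "u \<in> einterval x y" by simp
    from le[OF this] elim(1) show ?case
      by (meson mult_left_mono order_trans zero_le)
  qed
  then show ?thesis
    using x by (simp add: 2 haar_norm_infinity esssup_I)
qed

text \<open>This holds for arbitrary \<open>G\<close>: the upper integral is monotone without
  measurability, and \<open>esssup\<close> takes the value \<open>top\<close> at non-measurable
  functions, which makes the right-hand side trivial.\<close>

lemma haar_norm_subset:
  assumes q: "0 < q" and sub: "einterval x y \<subseteq> einterval x' y'"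
  shows "haar_norm q x y G \<le> haar_norm q x' y' G"
  using q
proof (cases rule: exponent_cases)
  case (1 s)
  have "(\<integral>\<^sup>+u. epowr (ennreal (u powr - recip q) * G u) s * indicator (einterval x y) u \<partial>lebesgue)
     \<le> (\<integral>\<^sup>+u. epowr (ennreal (u powr - recip q) * G u) s * indicator (einterval x' y') u \<partial>lebesgue)"
    using sub by (intro nn_integral_mono mult_left_mono) (auto simp: indicator_def)
  then show ?thesis
    using 1 by (simp add: haar_norm_def lebesgue_norm_def nn_integral_restrict_space recip_ereal epowr_mono)
next
  case 2
  let ?F = "\<lambda>u. ennreal (u powr - recip q) * G u"
  show ?thesis
  proof (cases "?F \<in> borel_measurable (lebesgue_on (einterval x' y'))")
    case True
    have "AE u in lebesgue. u \<in> einterval x' y' \<longrightarrow> ?F u \<le> esssup (lebesgue_on (einterval x' y')) ?F"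
      using esssup_AE[where M = "lebesgue_on (einterval x' y')" and f = ?F]
      by (subst (asm) AE_restrict_space_iff) auto
    then have "AE u in lebesgue_on (einterval x y). ?F u \<le> esssup (lebesgue_on (einterval x' y')) ?F"
      using sub by (subst AE_restrict_space_iff) (auto elim!: eventually_mono)
    then show ?thesis
      using measurable_subinterval[OF True sub] 2
      by (simp add: haar_norm_def lebesgue_norm_def esssup_I)
  next
    case False
    then show ?thesis
      using 2 by (simp add: haar_norm_def lebesgue_norm_def esssup_non_measurable)
  qed
qed

text \<open>Monotonicity in the end point does the work here, so nothing is asked of
  \<open>G\<close>.\<close>

lemma haar_norm_lower_measurable:
  assumes "0 < q"
  shows "(\<lambda>u. haar_norm q x (ereal u) G) \<in> borel_measurable borel"
proof (rule mono_ennreal_measurable, rule monoI)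
  fix u v :: real
  assume "u \<le> v"
  then have "ereal y < ereal u \<Longrightarrow> ereal y < ereal v" for y
    by simp
  then have "einterval x (ereal u) \<subseteq> einterval x (ereal v)"
    by (auto simp: einterval_iff)
  then show "haar_norm q x (ereal u) G \<le> haar_norm q x (ereal v) G"
    by (rule haar_norm_subset[OF assms])
qed

text \<open>The averages over \<open>(u, y)\<close> use \<open>k = 1\<close>, the Hardy operator
  over \<open>(u/2, y)\<close> uses \<open>k = 2\<close>.\<close>

lemma haar_norm_upper_measurable:
  assumes "0 < q" "0 \<le> k"
  shows "(\<lambda>u. haar_norm q (ereal (u / k)) y G) \<in> borel_measurable borel"
proof (rule antimono_ennreal_measurable, rule antimonoI)
  fix u v :: real
  assume "u \<le> v"
  then have "ereal (v / k) < ereal z \<Longrightarrow> ereal (u / k) < ereal z" for z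
    using divide_right_mono[of u v k] assms(2) by simp
  then have "einterval (ereal (v / k)) y \<subseteq> einterval (ereal (u / k)) y"
    by (auto simp: einterval_iff)
  then show "haar_norm q (ereal (v / k)) y G \<le> haar_norm q (ereal (u / k)) y G"
    by (rule haar_norm_subset[OF assms(1)])
qed

lemma einterval_mono: "x' \<le> x \<Longrightarrow> y \<le> y' \<Longrightarrow> einterval x y \<subseteq> einterval x' y'"
  by (auto simp: einterval_iff intro: le_less_trans less_le_trans)

section \<open>Norms of powers and of constants, with constants independent of the scale\<close>

lemma nn_integral_powr_from_0_le:
  assumes "0 < k" "0 \<le> c"
  shows "(\<integral>\<^sup>+u. ennreal (u powr (k - 1)) * indicator {0<..<c} u \<partial>lebesgue) \<le> ennreal (c powr k / k)"
proof -
  have "(\<integral>\<^sup>+u. ennreal (u powr (k - 1)) * indicator {0<..<c} u \<partial>lebesgue)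
     \<le> (\<integral>\<^sup>+u. ennreal (u powr (k - 1)) * indicator {0..c} u \<partial>lborel)"
    unfolding nn_integral_completion
    by (intro nn_integral_mono mult_left_mono) (auto simp: indicator_def)
  also have "\<dots> = ennreal (c powr k / k)"
    using has_integral_powr_from_0[of "k - 1" c] assms
    by (intro nn_integral_has_integral_lebesgue') auto
  finally show ?thesis .
qed

lemma nn_integral_powr_to_inf_le:
  assumes "0 < k" "0 < c"
  shows "(\<integral>\<^sup>+u. ennreal (u powr (- k - 1)) * indicator {c<..} u \<partial>lebesgue) \<le> ennreal (c powr - k / k)"
proof -
  have "(\<integral>\<^sup>+u. ennreal (u powr (- k - 1)) * indicator {c<..} u \<partial>lebesgue)
     \<le> (\<integral>\<^sup>+u. ennreal (u powr (- k - 1)) * indicator {c..} u \<partial>lborel)"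
    unfolding nn_integral_completion
    by (intro nn_integral_mono mult_left_mono) (auto simp: indicator_def)
  also have "\<dots> = ennreal (c powr - k / k)"
    using has_integral_powr_to_inf[of "- k - 1" c] assms
    by (intro nn_integral_has_integral_lebesgue') auto
  finally show ?thesis .
qed

lemma haar_norm_powr:
  assumes "0 \<le> x" "0 < s"
  shows "haar_norm (ereal s) x y (\<lambda>u. ennreal (u powr e)) =
    epowr (\<integral>\<^sup>+u. ennreal (u powr (e * s - 1)) * indicator (einterval x y) u \<partial>lebesgue) (1 / s)"
proof -
  have "(\<integral>\<^sup>+u. ennreal (inverse u) * epowr (ennreal (u powr e)) s * indicator (einterval x y) u \<partial>lebesgue)
    = (\<integral>\<^sup>+u. ennreal (u powr (e * s - 1)) * indicator (einterval x y) u \<partial>lebesgue)"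
  proof (rule nn_integral_cong)
    fix u
    show "ennreal (inverse u) * epowr (ennreal (u powr e)) s * indicator (einterval x y) u
      = ennreal (u powr (e * s - 1)) * indicator (einterval x y) u"
    proof (cases "u \<in> einterval x y")
      case True
      then have "0 < u"
        using einterval_pos[OF assms(1)] by blast
      then show ?thesis
        by (simp add: epowr_ennreal powr_powr powr_diff divide_inverse mult.commute flip: ennreal_mult)
    qed simp
  qed
  then show ?thesis
    using assms by (simp add: haar_norm_finite)
qed

lemma haar_norm_powr_from_0_le:
  assumes "0 < q" "0 < e"
  obtains C where "0 < C"
    "\<And>c. 0 < c \<Longrightarrow> haar_norm q 0 (ereal c) (\<lambda>u. ennreal (u powr e)) \<le> ennreal (C * c powr e)"
  using assms(1)
proof (cases rule: exponent_cases)
  case (1 s)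
  have "haar_norm q 0 (ereal c) (\<lambda>u. ennreal (u powr e)) \<le> ennreal ((1 / (e * s)) powr (1 / s) * c powr e)"
    if "0 < c" for c
  proof -
    have "haar_norm q 0 (ereal c) (\<lambda>u. ennreal (u powr e)) \<le> epowr (ennreal (c powr (e * s) / (e * s))) (1 / s)"
      using nn_integral_powr_from_0_le[of "e * s" c] 1 assms that
      by (simp add: haar_norm_powr epowr_mono zero_ereal_def)
    also have "\<dots> = ennreal ((1 / (e * s)) powr (1 / s) * c powr e)"
      using 1 assms that by (simp add: epowr_ennreal powr_divide powr_powr)
    finally show ?thesis .
  qed
  with 1 assms show ?thesis
    by (intro that[of "(1 / (e * s)) powr (1 / s)"]) auto
next
  case 2
  have "haar_norm q 0 (ereal c) (\<lambda>u. ennreal (u powr e)) \<le> ennreal (1 * c powr e)"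
    if "0 < c" for c
    unfolding 2 using assms(2)
    by (subst haar_norm_infinity) (auto simp: zero_ereal_def intro!: esssup_I AE_I2 ennreal_leI powr_mono2)
  then show ?thesis
    by (intro that[of 1]) auto
qed

lemma haar_norm_powr_to_inf_le:
  assumes "0 < q" "0 < e"
  obtains C where "0 < C"
    "\<And>c. 0 < c \<Longrightarrow> haar_norm q (ereal c) \<infinity> (\<lambda>u. ennreal (u powr - e)) \<le> ennreal (C * c powr - e)"
  using assms(1)
proof (cases rule: exponent_cases)
  case (1 s)
  have "haar_norm q (ereal c) \<infinity> (\<lambda>u. ennreal (u powr - e)) \<le> ennreal ((1 / (e * s)) powr (1 / s) * c powr - e)"
    if "0 < c" for c
  proof -
    have "haar_norm q (ereal c) \<infinity> (\<lambda>u. ennreal (u powr - e)) \<le> epowr (ennreal (c powr - (e * s) / (e * s))) (1 / s)"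
      using nn_integral_powr_to_inf_le[of "e * s" c] 1 assms that
      by (simp add: haar_norm_powr epowr_mono)
    also have "\<dots> = ennreal ((c powr - (e * s)) powr (1 / s) * (1 / (e * s)) powr (1 / s))"
      using 1 assms that by (subst epowr_ennreal) (auto simp: powr_divide)
    also have "(c powr - (e * s)) powr (1 / s) = c powr - e"
      using 1 by (simp only: powr_powr) simp
    finally show ?thesis by (simp add: mult.commute)
  qed
  with 1 assms show ?thesis
    by (intro that[of "(1 / (e * s)) powr (1 / s)"]) auto
next
  case 2
  have "haar_norm q (ereal c) \<infinity> (\<lambda>u. ennreal (u powr - e)) \<le> ennreal (1 * c powr - e)"
    if "0 < c" for c
    unfolding 2 using assms(2) that
    by (subst haar_norm_infinity) (auto intro!: esssup_I AE_I2 ennreal_leI powr_mono2')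
  then show ?thesis
    by (intro that[of 1]) auto
qed

text \<open>The interval \<open>(x, 2 * x)\<close> has the same measure for every \<open>x\<close>
  with respect to \<open>du/u\<close>. The bound \<open>1/u \<ge> 1/(2 * x)\<close> shows that this
  measure is at least \<open>1/2\<close>, whence the constant \<open>2 powr (1 / s)\<close>.\<close>

lemma haar_norm_const_ge:
  assumes "0 < q"
  obtains C where "0 < C"
    "\<And>x K. 0 < x \<Longrightarrow> K \<le> ennreal C * haar_norm q (ereal x) (ereal (2 * x)) (\<lambda>_. K)"
  using assms
proof (cases rule: exponent_cases)
  case (1 s)
  have "K \<le> ennreal (2 powr (1 / s)) * haar_norm q (ereal x) (ereal (2 * x)) (\<lambda>_. K)" if "0 < x" for x K
  proof -
    have "epowr K s = ennreal 2 * (ennreal (1 / (2 * x)) * epowr K s * ennreal x)"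
    proof -
      have "ennreal 2 * ennreal (1 / (2 * x)) * ennreal x = 1"
        using that by (simp flip: ennreal_mult del: ennreal_numeral)
      then show ?thesis by (metis mult.assoc mult.commute mult_1)
    qed
    also have "ennreal (1 / (2 * x)) * epowr K s * ennreal x =
        (\<integral>\<^sup>+u. ennreal (1 / (2 * x)) * epowr K s * indicator {x<..<2*x} u \<partial>lebesgue)"
      using that by (subst nn_integral_cmult_indicator) auto
    also have "\<dots> \<le> (\<integral>\<^sup>+u. ennreal (inverse u) * epowr K s * indicator {x<..<2*x} u \<partial>lebesgue)"
      using that
      by (intro nn_integral_mono) (auto simp: indicator_def inverse_eq_divide intro!: mult_right_mono ennreal_leI frac_le)
    finally have "epowr K s \<le> ennreal 2 * \<dots>"
      by (simp add: mult_left_mono)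
    then have "epowr (epowr K s) (1 / s) \<le> epowr (ennreal 2 * (\<integral>\<^sup>+u. ennreal (inverse u) * epowr K s * indicator {x<..<2*x} u \<partial>lebesgue)) (1 / s)"
      using 1 by (intro epowr_mono) auto
    then show ?thesis
      using 1 that by (simp add: epowr_inverse_right haar_norm_finite epowr_mult epowr_ennreal
          del: ennreal_numeral)
  qed
  then show ?thesis
    by (intro that[of "2 powr (1 / s)"]) auto
next
  case 2
  have "emeasure (lebesgue_on (einterval (ereal x) (ereal (2 * x)))) (space (lebesgue_on (einterval (ereal x) (ereal (2 * x))))) \<noteq> 0"
    if "0 < x" for x
    using that by (simp add: emeasure_restrict_space)
  then show ?thesis
    by (intro that[of 1]) (auto simp: 2 haar_norm_infinity esssup_const)
qed

text \<open>A quasi-triangle inequality suffices and covers exponents below 1. In its constant, 2 is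
  the root of \<open>2 powr s\<close> from the integrand, and \<open>2 powr (1 / s)\<close> comes
  from the outer root.\<close>

lemma haar_norm_add_le:
  assumes "0 < q"
  obtains C where "0 < C"
    "\<And>x y G H. 0 \<le> x \<Longrightarrow> G \<in> borel_measurable (lebesgue_on (einterval x y)) \<Longrightarrow>
      H \<in> borel_measurable (lebesgue_on (einterval x y)) \<Longrightarrow>
      haar_norm q x y (\<lambda>u. G u + H u) \<le> ennreal C * (haar_norm q x y G + haar_norm q x y H)"
  using assms
proof (cases rule: exponent_cases)
  case (1 s)
  have "haar_norm q x y (\<lambda>u. G u + H u) \<le> ennreal (2 * 2 powr (1 / s)) * (haar_norm q x y G + haar_norm q x y H)"
    if x: "0 \<le> x" and [measurable]: "G \<in> borel_measurable (lebesgue_on (einterval x y))"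
      "H \<in> borel_measurable (lebesgue_on (einterval x y))" for x y G H
  proof -
    let ?I = "indicator (einterval x y) :: real \<Rightarrow> ennreal"
    let ?J = "\<lambda>F. \<integral>\<^sup>+u. ennreal (inverse u) * epowr (F u) s * ?I u \<partial>lebesgue"
    have [measurable]: "(\<lambda>u. ennreal (inverse u) * epowr (G u) s * ?I u) \<in> borel_measurable lebesgue"
      "(\<lambda>u. ennreal (inverse u) * epowr (H u) s * ?I u) \<in> borel_measurable lebesgue"
      by (subst borel_measurable_restrict_space_iff_ennreal[symmetric]; measurable)+
    have "?J (\<lambda>u. G u + H u) \<le> (\<integral>\<^sup>+u. ennreal (2 powr s) *
        (ennreal (inverse u) * epowr (G u) s * ?I u + ennreal (inverse u) * epowr (H u) s * ?I u) \<partial>lebesgue)"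
    proof (rule nn_integral_mono)
      fix u
      have "ennreal (inverse u) * epowr (G u + H u) s * ?I u
        \<le> ennreal (inverse u) * (ennreal (2 powr s) * (epowr (G u) s + epowr (H u) s)) * ?I u"
        using 1 by (intro mult_left_mono mult_right_mono epowr_add_le) auto
      then show "ennreal (inverse u) * epowr (G u + H u) s * ?I u \<le> ennreal (2 powr s) *
        (ennreal (inverse u) * epowr (G u) s * ?I u + ennreal (inverse u) * epowr (H u) s * ?I u)"
        by (simp add: algebra_simps)
    qed
    also have "\<dots> = ennreal (2 powr s) * (?J G + ?J H)"
      by (simp add: nn_integral_cmult nn_integral_add)
    finally have "epowr (?J (\<lambda>u. G u + H u)) (1 / s) \<le> epowr (ennreal (2 powr s) * (?J G + ?J H)) (1 / s)"
      using 1 by (intro epowr_mono) auto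
    also have "\<dots> = ennreal 2 * epowr (?J G + ?J H) (1 / s)"
      using 1 by (simp add: epowr_mult epowr_ennreal powr_powr del: ennreal_numeral)
    also have "\<dots> \<le> ennreal 2 * (ennreal (2 powr (1 / s)) * (epowr (?J G) (1 / s) + epowr (?J H) (1 / s)))"
      using 1 by (intro mult_left_mono epowr_add_le) auto
    finally show ?thesis
      using 1 x by (simp add: haar_norm_finite ennreal_mult mult.assoc)
  qed
  then show ?thesis
    by (intro that[of "2 * 2 powr (1 / s)"]) auto
next
  case 2
  have "haar_norm q x y (\<lambda>u. G u + H u) \<le> ennreal 1 * (haar_norm q x y G + haar_norm q x y H)"
    if x: "0 \<le> x" and [measurable]: "G \<in> borel_measurable (lebesgue_on (einterval x y))"
      "H \<in> borel_measurable (lebesgue_on (einterval x y))" for x y G H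
  proof -
    have "AE u in lebesgue_on (einterval x y). G u + H u \<le>
      esssup (lebesgue_on (einterval x y)) G + esssup (lebesgue_on (einterval x y)) H"
      using esssup_AE[where M = "lebesgue_on (einterval x y)" and f = G]
        esssup_AE[where M = "lebesgue_on (einterval x y)" and f = H]
      by eventually_elim (rule add_mono)
    then show ?thesis
      using x by (simp add: 2 haar_norm_infinity esssup_I)
  qed
  then show ?thesis
    by (intro that[of 1]) auto
qed

text \<open>The two open intervals miss only the point \<open>t\<close>, a null set.\<close>

lemma haar_norm_split_le:
  assumes "0 < q"
  obtains C where "0 < C"
    "\<And>x t y G. 0 \<le> x \<Longrightarrow> x \<le> ereal t \<Longrightarrow> ereal t \<le> y \<Longrightarrow> G \<in> borel_measurable (lebesgue_on (einterval x y)) \<Longrightarrow>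
      haar_norm q x y G \<le> ennreal C * (haar_norm q x (ereal t) G + haar_norm q (ereal t) y G)"
proof -
  have AE: "AE u in lebesgue. u \<noteq> t" for t :: real
    by (rule AE_completion) (rule AE_lborel_singleton)
  have sub: "einterval x (ereal t) \<subseteq> einterval x y" "einterval (ereal t) y \<subseteq> einterval x y"
    if "x \<le> ereal t" "ereal t \<le> y" for x t y
    using that by (simp_all add: einterval_mono)
  show ?thesis
    using assms
  proof (cases rule: exponent_cases)
    case (1 s)
    have "haar_norm q x y G \<le> ennreal (2 powr (1 / s)) * (haar_norm q x (ereal t) G + haar_norm q (ereal t) y G)"
      if x: "0 \<le> x" "x \<le> ereal t" "ereal t \<le> y" and G: "G \<in> borel_measurable (lebesgue_on (einterval x y))"
      for x t y G
    proof -
      let ?f = "\<lambda>y z u. ennreal (inverse u) * epowr (G u) s * indicator (einterval y z) u"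
      have t: "0 \<le> ereal t"
        using x by order
      have [measurable]: "G \<in> borel_measurable (lebesgue_on (einterval x (ereal t)))"
        "G \<in> borel_measurable (lebesgue_on (einterval (ereal t) y))"
        using measurable_subinterval[OF G] sub[OF x(2,3)] by auto
      have meas: "?f x (ereal t) \<in> borel_measurable lebesgue" "?f (ereal t) y \<in> borel_measurable lebesgue"
        by (subst borel_measurable_restrict_space_iff_ennreal[symmetric]; measurable)+
      have "(\<integral>\<^sup>+u. ?f x y u \<partial>lebesgue) \<le> (\<integral>\<^sup>+u. ?f x (ereal t) u + ?f (ereal t) y u \<partial>lebesgue)"
        using AE[of t] by (intro nn_integral_mono_AE) (auto elim!: eventually_mono simp: indicator_def einterval_iff not_less)
      also have "\<dots> = (\<integral>\<^sup>+u. ?f x (ereal t) u \<partial>lebesgue) + (\<integral>\<^sup>+u. ?f (ereal t) y u \<partial>lebesgue)"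
        using meas by (rule nn_integral_add)
      finally have "haar_norm q x y G \<le> epowr \<dots> (1 / s)"
        using 1 x by (simp add: haar_norm_finite epowr_mono)
      also have "\<dots> \<le> ennreal (2 powr (1 / s)) * (haar_norm q x (ereal t) G + haar_norm q (ereal t) y G)"
        using epowr_add_le[of "1 / s" "\<integral>\<^sup>+u. ?f x (ereal t) u \<partial>lebesgue" "\<integral>\<^sup>+u. ?f (ereal t) y u \<partial>lebesgue"] 1 x(1) t
        by (simp add: haar_norm_finite)
      finally show ?thesis .
    qed
    then show ?thesis
      by (intro that[of "2 powr (1 / s)"]) auto
  next
    case 2
    have "haar_norm q x y G \<le> ennreal 1 * (haar_norm q x (ereal t) G + haar_norm q (ereal t) y G)"
      if x: "0 \<le> x" "x \<le> ereal t" "ereal t \<le> y" and G: "G \<in> borel_measurable (lebesgue_on (einterval x y))"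
      for x t y G
    proof -
      have t: "0 \<le> ereal t"
        using x by order
      have "AE u in lebesgue. u \<in> einterval x (ereal t) \<longrightarrow> G u \<le> esssup (lebesgue_on (einterval x (ereal t))) G"
        using esssup_AE[where M = "lebesgue_on (einterval x (ereal t))" and f = G]
        by (subst (asm) AE_restrict_space_iff) auto
      moreover have "AE u in lebesgue. u \<in> einterval (ereal t) y \<longrightarrow> G u \<le> esssup (lebesgue_on (einterval (ereal t) y)) G"
        using esssup_AE[where M = "lebesgue_on (einterval (ereal t) y)" and f = G]
        by (subst (asm) AE_restrict_space_iff) auto
      ultimately have "AE u in lebesgue. u \<in> einterval x y \<longrightarrow> G u \<le>
        esssup (lebesgue_on (einterval x (ereal t))) G + esssup (lebesgue_on (einterval (ereal t) y)) G"
        using AE[of t]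
      proof eventually_elim
        case (elim u)
        show ?case
        proof
          assume "u \<in> einterval x y"
          with elim(3) consider "u \<in> einterval x (ereal t)" | "u \<in> einterval (ereal t) y"
            by (force simp: einterval_iff)
          then show "G u \<le> esssup (lebesgue_on (einterval x (ereal t))) G + esssup (lebesgue_on (einterval (ereal t) y)) G"
            using elim(1,2) by cases (auto intro: add_increasing add_increasing2)
        qed
      qed
      then have "AE u in lebesgue_on (einterval x y). G u \<le>
        esssup (lebesgue_on (einterval x (ereal t))) G + esssup (lebesgue_on (einterval (ereal t) y)) G"
        by (subst AE_restrict_space_iff) auto
      then show ?thesis
        using x t G measurable_subinterval[OF G] sub[OF x(2,3)] by (simp add: 2 haar_norm_infinity esssup_I)
    qed
    then show ?thesis
      by (intro that[of 1]) auto
  qed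
qed

section \<open>Hardy inequalities with equal exponents\<close>

text \<open>The functions at hand are only known to be Lebesgue measurable, so Tonelli's theorem is
  used on a product of completed measures. An exhaustion for \<open>lborel\<close> also serves its
  completion.\<close>

lemma sigma_finite_lebesgue: "sigma_finite_measure (lebesgue :: real measure)"
proof
  obtain A :: "nat \<Rightarrow> real set" where A: "range A \<subseteq> sets lborel" "(\<Union>i. A i) = space lborel" "\<And>i. emeasure lborel (A i) \<noteq> \<infinity>"
    using lborel.sigma_finite by blast
  have "emeasure lebesgue (A i) = emeasure lborel (A i)" for i
    using A(1) by (subst emeasure_completion) (auto simp: image_subset_iff)
  with A show "\<exists>A :: real set set. countable A \<and> A \<subseteq> sets lebesgue \<and> \<Union> A = space lebesgue \<and> (\<forall>a\<in>A. emeasure lebesgue a \<noteq> \<infinity>)"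
    by (intro exI[of _ "range A"]) (auto simp: image_subset_iff)
qed

text \<open>Tonelli's theorem moves the \<open>u\<close>-integral onto the kernel. A Borel kernel is
  jointly measurable for the completed measures by composition with the projections, while
  \<open>F\<close> depends on one variable only. The bound is required only where \<open>F\<close>
  is nonzero, since in the application it is known only for \<open>w > 0\<close>.\<close>

lemma nn_integral_kernel_le:
  fixes K :: "real \<Rightarrow> real \<Rightarrow> ennreal"
  assumes K [measurable]: "case_prod K \<in> borel_measurable (borel \<Otimes>\<^sub>M borel)"
    and F [measurable]: "F \<in> borel_measurable lebesgue"
    and le: "\<And>w. F w \<noteq> 0 \<Longrightarrow> (\<integral>\<^sup>+u. K u w \<partial>lebesgue) \<le> c"
  shows "(\<integral>\<^sup>+u. \<integral>\<^sup>+w. K u w * F w \<partial>lebesgue \<partial>lebesgue) \<le> c * (\<integral>\<^sup>+w. F w \<partial>lebesgue)"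
proof -
  interpret pair_sigma_finite "lebesgue :: real measure" "lebesgue :: real measure"
    by (intro pair_sigma_finite.intro sigma_finite_lebesgue)
  have [measurable]: "(\<lambda>x. K (fst x) (snd x)) \<in> borel_measurable (lebesgue \<Otimes>\<^sub>M lebesgue)"
  proof -
    have "(\<lambda>x. (fst x, snd x)) \<in> measurable (lebesgue \<Otimes>\<^sub>M lebesgue) ((borel :: real measure) \<Otimes>\<^sub>M (borel :: real measure))"
      by (intro measurable_Pair measurable_compose[OF measurable_fst] measurable_compose[OF measurable_snd] ident_lebesgue)
    from measurable_compose[OF this K] show ?thesis by simp
  qed
  have [measurable]: "(\<lambda>u. K u w) \<in> borel_measurable lebesgue" for w
    using measurable_compose[OF measurable_Pair2'[of w borel borel] K] by (intro measurable_completion) simp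
  have "(\<integral>\<^sup>+u. \<integral>\<^sup>+w. K u w * F w \<partial>lebesgue \<partial>lebesgue) = (\<integral>\<^sup>+w. \<integral>\<^sup>+u. K u w * F w \<partial>lebesgue \<partial>lebesgue)"
    by (rule Fubini') (simp add: split_beta')
  also have "\<dots> = (\<integral>\<^sup>+w. (\<integral>\<^sup>+u. K u w \<partial>lebesgue) * F w \<partial>lebesgue)"
    by (intro nn_integral_cong nn_integral_multc) simp
  also have "\<dots> \<le> (\<integral>\<^sup>+w. c * F w \<partial>lebesgue)"
    using le by (intro nn_integral_mono) (metis mult_right_mono mult_zero_right order_refl zero_le)
  also have "\<dots> = c * (\<integral>\<^sup>+w. F w \<partial>lebesgue)"
    by (rule nn_integral_cmult) simp
  finally show ?thesis .
qed

text \<open>When the inner and outer exponents agree, the \<open>s\<close>-th power of the left-hand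
  side is a double integral, for every \<open>s > 0\<close>. The region \<open>R\<close> contains
  the domain of integration and does not depend on \<open>T\<close>, so neither does the constant.
  The sign of \<open>e\<close> is free: a negative \<open>e\<close> gives averages over
  \<open>(0, u)\<close>, a positive one averages towards \<open>T\<close>.\<close>

lemma haar_norm_powr_kernel_le:
  assumes s: "0 < s" and C: "0 \<le> C"
    and R [measurable]: "R \<in> sets (borel \<Otimes>\<^sub>M borel)"
    and G [measurable]: "G \<in> borel_measurable (lebesgue_on (einterval 0 T))"
    and xy: "\<And>u. u \<in> einterval 0 T \<Longrightarrow> 0 \<le> x u \<and> y u \<le> T"
    and sub: "\<And>u w. u \<in> einterval 0 T \<Longrightarrow> w \<in> einterval (x u) (y u) \<Longrightarrow> (u, w) \<in> R"
    and le: "\<And>w. 0 < w \<Longrightarrow>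
       (\<integral>\<^sup>+u. ennreal (u powr (e * s - 1)) * indicator R (u, w) \<partial>lebesgue) \<le> ennreal (C * w powr (e * s))"
  shows "haar_norm (ereal s) 0 T
       (\<lambda>u. ennreal (u powr e) * haar_norm (ereal s) (x u) (y u) (\<lambda>w. ennreal (w powr - e) * G w))
     \<le> ennreal (C powr (1 / s)) * haar_norm (ereal s) 0 T G"
proof -
  \<comment> \<open>\<open>F\<close> is the integrand of the norm of \<open>G\<close>. In
    \<open>K\<close>, the power of \<open>u\<close> combines the outer weight with
    \<open>du/u\<close>, and the power of \<open>w\<close> comes from the inner weight.\<close>
  define F where "F = (\<lambda>w. ennreal (inverse w) * epowr (G w) s * indicator (einterval 0 T) w)"
  define K where "K = (\<lambda>u w. ennreal (u powr (e * s - 1)) * indicator R (u, w) * ennreal (w powr - (e * s)))"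
  have F [measurable]: "F \<in> borel_measurable lebesgue"
    unfolding F_def by (subst borel_measurable_restrict_space_iff_ennreal[symmetric]; measurable)+
  have K [measurable]: "case_prod K \<in> borel_measurable (borel \<Otimes>\<^sub>M borel)"
    unfolding K_def by measurable
  have [measurable]: "(\<lambda>u. ennreal (u powr (e * s - 1)) * indicator R (u, w)) \<in> borel_measurable lebesgue" for w
  proof (intro measurable_completion)
    have "(\<lambda>(u, w). ennreal (u powr (e * s - 1)) * indicator R (u, w)) \<in> borel_measurable (borel \<Otimes>\<^sub>M borel)"
      by measurable
    from measurable_compose[OF measurable_Pair2'[of w borel borel] this]
    show "(\<lambda>u. ennreal (u powr (e * s - 1)) * indicator R (u, w)) \<in> borel_measurable lborel"
      by simp
  qed
  have Kle: "(\<integral>\<^sup>+u. K u w \<partial>lebesgue) \<le> ennreal C" if "F w \<noteq> 0" for w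
  proof -
    have w: "0 < w"
      using that by (auto simp: F_def indicator_def einterval_iff split: if_splits)
    have "(\<integral>\<^sup>+u. K u w \<partial>lebesgue) =
       (\<integral>\<^sup>+u. ennreal (u powr (e * s - 1)) * indicator R (u, w) \<partial>lebesgue) * ennreal (w powr - (e * s))"
      unfolding K_def by (rule nn_integral_multc) measurable
    also have "\<dots> \<le> ennreal (C * w powr (e * s)) * ennreal (w powr - (e * s))"
      by (intro mult_right_mono le w) simp
    also have "\<dots> = ennreal C"
      using w C by (simp add: powr_minus flip: ennreal_mult)
    finally show ?thesis .
  qed
  have "(\<integral>\<^sup>+u. ennreal (inverse u) *
        epowr (ennreal (u powr e) * haar_norm (ereal s) (x u) (y u) (\<lambda>w. ennreal (w powr - e) * G w)) s *
        indicator (einterval 0 T) u \<partial>lebesgue)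
    \<le> (\<integral>\<^sup>+u. \<integral>\<^sup>+w. K u w * F w \<partial>lebesgue \<partial>lebesgue)"
  proof (rule nn_integral_mono)
    fix u
    show "ennreal (inverse u) *
        epowr (ennreal (u powr e) * haar_norm (ereal s) (x u) (y u) (\<lambda>w. ennreal (w powr - e) * G w)) s *
        indicator (einterval 0 T) u \<le> (\<integral>\<^sup>+w. K u w * F w \<partial>lebesgue)"
    proof (cases "u \<in> einterval 0 T")
      case True
      with xy have xu: "0 \<le> x u" and yu: "y u \<le> T" and u: "0 < u"
        by (auto simp: einterval_iff)
      let ?E = "\<lambda>w. ennreal (inverse w) * epowr (ennreal (w powr - e) * G w) s * indicator (einterval (x u) (y u)) w"
      have [measurable]: "G \<in> borel_measurable (lebesgue_on (einterval (x u) (y u)))"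
        by (rule measurable_subinterval[OF G einterval_mono[OF xu yu]])
      have [measurable]: "?E \<in> borel_measurable lebesgue"
        by (subst borel_measurable_restrict_space_iff_ennreal[symmetric]; measurable)+
      have "ennreal (inverse u) * epowr (ennreal (u powr e)) s = ennreal (u powr (e * s - 1))"
        using u by (simp add: epowr_ennreal powr_powr powr_diff divide_inverse mult.commute flip: ennreal_mult)
      then have "ennreal (inverse u) *
          epowr (ennreal (u powr e) * haar_norm (ereal s) (x u) (y u) (\<lambda>w. ennreal (w powr - e) * G w)) s
         = ennreal (u powr (e * s - 1)) * (\<integral>\<^sup>+w. ?E w \<partial>lebesgue)"
        using s xu by (simp add: haar_norm_finite epowr_mult epowr_inverse_left flip: mult.assoc)
      also have "\<dots> = (\<integral>\<^sup>+w. ennreal (u powr (e * s - 1)) * ?E w \<partial>lebesgue)"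
        by (rule nn_integral_cmult[symmetric]) measurable
      also have "\<dots> \<le> (\<integral>\<^sup>+w. K u w * F w \<partial>lebesgue)"
      proof (rule nn_integral_mono)
        fix w
        show "ennreal (u powr (e * s - 1)) * ?E w \<le> K u w * F w"
        proof (cases "w \<in> einterval (x u) (y u)")
          case w: True
          then have "w \<in> einterval 0 T" "(u, w) \<in> R"
            using einterval_mono[OF xu yu] sub[OF True w] by auto
          moreover have "epowr (ennreal (w powr - e)) s = ennreal (w powr - (e * s))"
            by (simp add: epowr_ennreal powr_powr)
          ultimately show ?thesis
            using w s by (simp add: K_def F_def epowr_mult mult_ac)
        qed simp
      qed
      finally show ?thesis
        using True by simp
    qed simp
  qed
  also have "\<dots> \<le> ennreal C * (\<integral>\<^sup>+w. F w \<partial>lebesgue)"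
    by (rule nn_integral_kernel_le[OF K F Kle])
  finally have "haar_norm (ereal s) 0 T
       (\<lambda>u. ennreal (u powr e) * haar_norm (ereal s) (x u) (y u) (\<lambda>w. ennreal (w powr - e) * G w))
     \<le> epowr (ennreal C * (\<integral>\<^sup>+w. F w \<partial>lebesgue)) (1 / s)"
    using s by (simp add: haar_norm_finite epowr_mono)
  also have "\<dots> = ennreal (C powr (1 / s)) * haar_norm (ereal s) 0 T G"
    using s C by (simp add: haar_norm_finite epowr_mult epowr_ennreal F_def)
  finally show ?thesis .
qed

text \<open>After the exchange of integrals what remains is the integral of
  \<open>u powr (- (e * s) - 1)\<close> over \<open>u > w\<close>. The constant serves all
  \<open>T\<close>, so that the inequality can be used on every interval \<open>(0, t)\<close> of an
  iterated norm.\<close>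

lemma haar_norm_Hardy_lower:
  assumes q: "0 < q" and e: "0 < e"
  obtains C where "0 < C"
    "\<And>T G. G \<in> borel_measurable (lebesgue_on (einterval 0 T)) \<Longrightarrow>
      haar_norm q 0 T (\<lambda>u. ennreal (u powr - e) * haar_norm q 0 (ereal u) (\<lambda>w. ennreal (w powr e) * G w))
      \<le> ennreal C * haar_norm q 0 T G"
  using q
proof (cases rule: exponent_cases)
  case (1 s)
  let ?R = "{(u :: real, w :: real). 0 < w \<and> w < u}"
  have "{x \<in> space (borel \<Otimes>\<^sub>M borel). 0 < snd x \<and> snd x < fst x} \<in> sets (borel \<Otimes>\<^sub>M (borel :: real measure))"
    by measurable
  then have R: "?R \<in> sets (borel \<Otimes>\<^sub>M borel)"
    by (simp add: split_beta' space_pair_measure)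
  have "haar_norm (ereal s) 0 T (\<lambda>u. ennreal (u powr - e) * haar_norm (ereal s) 0 (ereal u) (\<lambda>w. ennreal (w powr - (- e)) * G w))
      \<le> ennreal ((1 / (e * s)) powr (1 / s)) * haar_norm (ereal s) 0 T G"
    if G: "G \<in> borel_measurable (lebesgue_on (einterval 0 T))" for T G
  proof (rule haar_norm_powr_kernel_le[where R = ?R, OF 1(1) _ _ G])
    show "?R \<in> sets (borel \<Otimes>\<^sub>M borel)"
      by (rule R)
    fix w :: real
    assume w: "0 < w"
    have "(\<integral>\<^sup>+u. ennreal (u powr (- e * s - 1)) * indicator ?R (u, w) \<partial>lebesgue)
       = (\<integral>\<^sup>+u. ennreal (u powr (- (e * s) - 1)) * indicator {w<..} u \<partial>lebesgue)"
      using w by (intro nn_integral_cong) (auto simp: indicator_def)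
    also have "\<dots> \<le> ennreal (w powr - (e * s) / (e * s))"
      using e 1 w by (intro nn_integral_powr_to_inf_le) auto
    finally show "(\<integral>\<^sup>+u. ennreal (u powr (- e * s - 1)) * indicator ?R (u, w) \<partial>lebesgue)
       \<le> ennreal (1 / (e * s) * w powr (- e * s))"
      by simp
  qed (use e 1 in \<open>auto simp: einterval_iff\<close>)
  then show ?thesis
    using e 1 by (intro that[of "(1 / (e * s)) powr (1 / s)"]) auto
next
  case 2
  have "haar_norm q 0 T (\<lambda>u. ennreal (u powr - e) * haar_norm q 0 (ereal u) (\<lambda>w. ennreal (w powr e) * G w))
      \<le> ennreal 1 * haar_norm q 0 T G"
    if G [measurable]: "G \<in> borel_measurable (lebesgue_on (einterval 0 T))" for T G
  proof -
    define N where "N = esssup (lebesgue_on (einterval 0 T)) G"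
    have [measurable]: "(\<lambda>u. haar_norm q 0 (ereal u) (\<lambda>w. ennreal (w powr e) * G w)) \<in> borel_measurable (lebesgue_on S)" for S
      by (intro borel_imp_lebesgue_on haar_norm_lower_measurable q)
    have AE: "AE w in lebesgue. w \<in> einterval 0 T \<longrightarrow> G w \<le> N"
      using esssup_AE[where M = "lebesgue_on (einterval 0 T)" and f = G]
      unfolding N_def by (subst (asm) AE_restrict_space_iff) auto
    have "ennreal (u powr - e) * haar_norm q 0 (ereal u) (\<lambda>w. ennreal (w powr e) * G w) \<le> N"
      if u: "u \<in> einterval 0 T" for u
    proof -
      have u0: "0 < u" "ereal u \<le> T"
        using u by (auto simp: einterval_iff)
      have G' [measurable]: "G \<in> borel_measurable (lebesgue_on (einterval 0 (ereal u)))"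
        by (rule measurable_subinterval[OF G einterval_mono]) (use u0 in auto)
      have "AE w in lebesgue. w \<in> einterval 0 (ereal u) \<longrightarrow> ennreal (w powr e) * G w \<le> ennreal (u powr e) * N"
        using AE
      proof eventually_elim
        case (elim w)
        show ?case
        proof
          assume "w \<in> einterval 0 (ereal u)"
          then have "w \<in> einterval 0 T" "0 \<le> w" "w \<le> u"
            using einterval_mono[of 0 0 "ereal u" T] u0 by (auto simp: einterval_iff)
          then show "ennreal (w powr e) * G w \<le> ennreal (u powr e) * N"
            using elim e by (intro mult_mono ennreal_leI powr_mono2) auto
        qed
      qed
      then have "haar_norm q 0 (ereal u) (\<lambda>w. ennreal (w powr e) * G w) \<le> ennreal (u powr e) * N"
        unfolding 2 by (subst haar_norm_infinity) (auto intro!: esssup_I simp: AE_restrict_space_iff)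
      then have "ennreal (u powr - e) * haar_norm q 0 (ereal u) (\<lambda>w. ennreal (w powr e) * G w)
         \<le> ennreal (u powr - e) * (ennreal (u powr e) * N)"
        by (rule mult_left_mono) simp
      also have "\<dots> = N"
        using u0 by (simp add: powr_minus flip: ennreal_mult mult.assoc)
      finally show ?thesis .
    qed
    then have "haar_norm \<infinity> 0 T (\<lambda>u. ennreal (u powr - e) * haar_norm q 0 (ereal u) (\<lambda>w. ennreal (w powr e) * G w)) \<le> N"
      by (subst haar_norm_infinity) (auto intro!: esssup_I AE_I2)
    then show ?thesis
      using 2 by (simp add: N_def haar_norm_infinity)
  qed
  then show ?thesis
    by (intro that[of 1]) auto
qed

text \<open>The lower limit \<open>u / 2\<close> leaves room for the dyadic intervals
  \<open>(v/2, v)\<close> of all points \<open>v > u\<close>. It enlarges the region to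
  \<open>u < 2 * w\<close> and so only adds the factor \<open>2 powr e\<close> to the
  constant.\<close>

lemma haar_norm_Hardy_upper:
  assumes q: "0 < q" and e: "0 < e"
  obtains C where "0 < C"
    "\<And>T G. G \<in> borel_measurable (lebesgue_on (einterval 0 T)) \<Longrightarrow>
      haar_norm q 0 T (\<lambda>u. ennreal (u powr e) * haar_norm q (ereal (u / 2)) T (\<lambda>w. ennreal (w powr - e) * G w))
      \<le> ennreal C * haar_norm q 0 T G"
  using q
proof (cases rule: exponent_cases)
  case (1 s)
  let ?R = "{(u :: real, w :: real). 0 < u \<and> u < 2 * w}"
  have "{x \<in> space (borel \<Otimes>\<^sub>M borel). 0 < fst x \<and> fst x < 2 * snd x} \<in> sets (borel \<Otimes>\<^sub>M (borel :: real measure))"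
    by measurable
  then have R: "?R \<in> sets (borel \<Otimes>\<^sub>M borel)"
    by (simp add: split_beta' space_pair_measure)
  have "haar_norm (ereal s) 0 T (\<lambda>u. ennreal (u powr e) * haar_norm (ereal s) (ereal (u / 2)) T (\<lambda>w. ennreal (w powr - e) * G w))
      \<le> ennreal ((2 powr (e * s) / (e * s)) powr (1 / s)) * haar_norm (ereal s) 0 T G"
    if G: "G \<in> borel_measurable (lebesgue_on (einterval 0 T))" for T G
  proof (rule haar_norm_powr_kernel_le[where R = ?R, OF 1(1) _ _ G])
    show "?R \<in> sets (borel \<Otimes>\<^sub>M borel)"
      by (rule R)
    fix w :: real
    assume w: "0 < w"
    have "(\<integral>\<^sup>+u. ennreal (u powr (e * s - 1)) * indicator ?R (u, w) \<partial>lebesgue)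
       = (\<integral>\<^sup>+u. ennreal (u powr (e * s - 1)) * indicator {0<..<2 * w} u \<partial>lebesgue)"
      by (intro nn_integral_cong) (auto simp: indicator_def)
    also have "\<dots> \<le> ennreal ((2 * w) powr (e * s) / (e * s))"
      using e 1 w by (intro nn_integral_powr_from_0_le) auto
    finally show "(\<integral>\<^sup>+u. ennreal (u powr (e * s - 1)) * indicator ?R (u, w) \<partial>lebesgue)
       \<le> ennreal (2 powr (e * s) / (e * s) * w powr (e * s))"
      using w by (simp add: powr_mult)
  qed (use e 1 in \<open>auto simp: einterval_iff\<close>)
  then show ?thesis
    using e 1 by (intro that[of "(2 powr (e * s) / (e * s)) powr (1 / s)"]) auto
next
  case 2
  have "haar_norm q 0 T (\<lambda>u. ennreal (u powr e) * haar_norm q (ereal (u / 2)) T (\<lambda>w. ennreal (w powr - e) * G w))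
      \<le> ennreal (2 powr e) * haar_norm q 0 T G"
    if G [measurable]: "G \<in> borel_measurable (lebesgue_on (einterval 0 T))" for T G
  proof -
    define N where "N = esssup (lebesgue_on (einterval 0 T)) G"
    have [measurable]: "(\<lambda>u. haar_norm q (ereal (u / 2)) T (\<lambda>w. ennreal (w powr - e) * G w)) \<in> borel_measurable (lebesgue_on S)" for S
      by (intro borel_imp_lebesgue_on haar_norm_upper_measurable q) simp
    have AE: "AE w in lebesgue. w \<in> einterval 0 T \<longrightarrow> G w \<le> N"
      using esssup_AE[where M = "lebesgue_on (einterval 0 T)" and f = G]
      unfolding N_def by (subst (asm) AE_restrict_space_iff) auto
    have "ennreal (u powr e) * haar_norm q (ereal (u / 2)) T (\<lambda>w. ennreal (w powr - e) * G w) \<le> ennreal (2 powr e) * N"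
      if u: "u \<in> einterval 0 T" for u
    proof -
      have u0: "0 < u" "0 \<le> ereal (u / 2)"
        using u by (auto simp: einterval_iff)
      have G' [measurable]: "G \<in> borel_measurable (lebesgue_on (einterval (ereal (u / 2)) T))"
        by (rule measurable_subinterval[OF G einterval_mono]) (use u0 in auto)
      have "AE w in lebesgue. w \<in> einterval (ereal (u / 2)) T \<longrightarrow> ennreal (w powr - e) * G w \<le> ennreal ((u / 2) powr - e) * N"
        using AE
      proof eventually_elim
        case (elim w)
        show ?case
        proof
          assume w: "w \<in> einterval (ereal (u / 2)) T"
          then have "w \<in> einterval 0 T"
            using einterval_mono[OF u0(2) order_refl[of T]] by blast
          moreover have "u / 2 \<le> w"
            using w by (simp add: einterval_iff)
          ultimately show "ennreal (w powr - e) * G w \<le> ennreal ((u / 2) powr - e) * N"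
            using elim e u0 by (intro mult_mono ennreal_leI powr_mono2') auto
        qed
      qed
      then have "haar_norm q (ereal (u / 2)) T (\<lambda>w. ennreal (w powr - e) * G w) \<le> ennreal ((u / 2) powr - e) * N"
        unfolding 2 by (subst haar_norm_infinity) (use u0 in \<open>auto intro!: esssup_I simp: AE_restrict_space_iff\<close>)
      then have "ennreal (u powr e) * haar_norm q (ereal (u / 2)) T (\<lambda>w. ennreal (w powr - e) * G w)
         \<le> ennreal (u powr e) * (ennreal ((u / 2) powr - e) * N)"
        by (rule mult_left_mono) simp
      also have "\<dots> = ennreal (u powr e * (u / 2) powr - e) * N"
        by (simp add: ennreal_mult mult.assoc)
      also have "u powr e * (u / 2) powr - e = 2 powr e"
        using u0 by (simp add: powr_minus powr_divide)
      finally show ?thesis .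
    qed
    then have "haar_norm \<infinity> 0 T (\<lambda>u. ennreal (u powr e) * haar_norm q (ereal (u / 2)) T (\<lambda>w. ennreal (w powr - e) * G w))
       \<le> ennreal (2 powr e) * N"
      by (subst haar_norm_infinity) (auto intro!: esssup_I AE_I2)
    then show ?thesis
      using 2 by (simp add: N_def haar_norm_infinity)
  qed
  then show ?thesis
    by (intro that[of "2 powr e"]) auto
qed

section \<open>Regularly varying weights\<close>

text \<open>
  The Potter bounds of a regularly varying function of index \<open>\<rho>\<close>. Slowly varying functions have
  index 0, and products and quotients stay in the class.
\<close>

definition regvar :: "ereal \<Rightarrow> real \<Rightarrow> (real \<Rightarrow> real) \<Rightarrow> bool" where
  "regvar L \<rho> \<phi> \<longleftrightarrow>
     \<phi> \<in> borel_measurable (lebesgue_on (einterval 0 L)) \<and> (\<forall>t\<in>einterval 0 L. 0 < \<phi> t) \<and>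
     (\<forall>\<epsilon>>0. \<exists>C>0. \<forall>x y. 0 < x \<longrightarrow> x \<le> y \<longrightarrow> ereal y < L \<longrightarrow>
        \<phi> y \<le> C * (y / x) powr (\<rho> + \<epsilon>) * \<phi> x \<and> \<phi> x \<le> C * (y / x) powr (\<epsilon> - \<rho>) * \<phi> y)"

lemma regvar_measurable: "regvar L \<rho> \<phi> \<Longrightarrow> \<phi> \<in> borel_measurable (lebesgue_on (einterval 0 L))"
  by (simp add: regvar_def)

lemma regvar_pos: "regvar L \<rho> \<phi> \<Longrightarrow> 0 < t \<Longrightarrow> ereal t < L \<Longrightarrow> 0 < \<phi> t"
  by (simp add: regvar_def einterval_iff)

lemma regvar_bounds:
  assumes "regvar L \<rho> \<phi>" "0 < \<epsilon>"
  obtains C where "0 < C"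
    "\<And>x y. 0 < x \<Longrightarrow> x \<le> y \<Longrightarrow> ereal y < L \<Longrightarrow> \<phi> y \<le> C * (y / x) powr (\<rho> + \<epsilon>) * \<phi> x"
    "\<And>x y. 0 < x \<Longrightarrow> x \<le> y \<Longrightarrow> ereal y < L \<Longrightarrow> \<phi> x \<le> C * (y / x) powr (\<epsilon> - \<rho>) * \<phi> y"
proof -
  from assms obtain C where "0 < C" "\<forall>x y. 0 < x \<longrightarrow> x \<le> y \<longrightarrow> ereal y < L \<longrightarrow>
      \<phi> y \<le> C * (y / x) powr (\<rho> + \<epsilon>) * \<phi> x \<and> \<phi> x \<le> C * (y / x) powr (\<epsilon> - \<rho>) * \<phi> y"
    unfolding regvar_def by meson
  then show thesis
    by (intro that) auto
qed

lemma regvar_upper_bound: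
  assumes "regvar L \<rho> \<phi>" "0 < \<epsilon>"
  obtains C where "0 < C"
    "\<And>x y. 0 < x \<Longrightarrow> x \<le> y \<Longrightarrow> ereal y < L \<Longrightarrow> \<phi> y \<le> C * (y / x) powr (\<rho> + \<epsilon>) * \<phi> x"
proof (rule regvar_bounds[OF assms])
  fix C
  assume "0 < C"
    and "\<And>x y. 0 < x \<Longrightarrow> x \<le> y \<Longrightarrow> ereal y < L \<Longrightarrow> \<phi> y \<le> C * (y / x) powr (\<rho> + \<epsilon>) * \<phi> x"
  then show thesis
    by (rule that)
qed

lemma regvar_lower_bound:
  assumes "regvar L \<rho> \<phi>" "0 < \<epsilon>"
  obtains C where "0 < C"
    "\<And>x y. 0 < x \<Longrightarrow> x \<le> y \<Longrightarrow> ereal y < L \<Longrightarrow> \<phi> x \<le> C * (y / x) powr (\<epsilon> - \<rho>) * \<phi> y"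
proof (rule regvar_bounds[OF assms])
  fix C
  assume "0 < C"
    and "\<And>x y. 0 < x \<Longrightarrow> x \<le> y \<Longrightarrow> ereal y < L \<Longrightarrow> \<phi> x \<le> C * (y / x) powr (\<epsilon> - \<rho>) * \<phi> y"
  then show thesis
    by (rule that)
qed

lemma regvar_powr: "regvar L \<rho> (\<lambda>u. u powr \<rho>)"
  unfolding regvar_def
proof (intro conjI allI impI ballI)
  show "(\<lambda>u. u powr \<rho>) \<in> borel_measurable (lebesgue_on (einterval 0 L))"
    by measurable
  fix \<epsilon> :: real
  assume e: "0 < \<epsilon>"
  have "y powr \<rho> \<le> 1 * (y / x) powr (\<rho> + \<epsilon>) * x powr \<rho> \<and> x powr \<rho> \<le> 1 * (y / x) powr (\<epsilon> - \<rho>) * y powr \<rho>"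
    if xy: "0 < x" "x \<le> y" for x y
  proof -
    have "1 \<le> (y / x) powr \<epsilon>"
      using xy e by (simp add: ge_one_powr_ge_zero)
    moreover have "(y / x) powr (\<rho> + \<epsilon>) * x powr \<rho> = (y / x) powr \<epsilon> * y powr \<rho>"
      "(y / x) powr (\<epsilon> - \<rho>) * y powr \<rho> = (y / x) powr \<epsilon> * x powr \<rho>"
      using xy by (simp_all add: powr_add powr_diff powr_divide)
    ultimately show ?thesis
      using mult_right_mono[of 1 "(y / x) powr \<epsilon>"] by simp
  qed
  then show "\<exists>C>0. \<forall>x y. 0 < x \<longrightarrow> x \<le> y \<longrightarrow> ereal y < L \<longrightarrow>
        y powr \<rho> \<le> C * (y / x) powr (\<rho> + \<epsilon>) * x powr \<rho> \<and> x powr \<rho> \<le> C * (y / x) powr (\<epsilon> - \<rho>) * y powr \<rho>"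
    by (intro exI[of _ 1]) simp
qed (auto simp: einterval_iff)

lemma regvar_mult:
  assumes "regvar L \<rho> \<phi>" "regvar L \<sigma> \<psi>"
  shows "regvar L (\<rho> + \<sigma>) (\<lambda>u. \<phi> u * \<psi> u)"
  unfolding regvar_def
proof (intro conjI allI impI ballI)
  show "(\<lambda>u. \<phi> u * \<psi> u) \<in> borel_measurable (lebesgue_on (einterval 0 L))"
    using assms[THEN regvar_measurable] by simp
  show "0 < \<phi> t * \<psi> t" if "t \<in> einterval 0 L" for t
    using that assms[THEN regvar_pos] by (simp add: einterval_iff)
  fix \<epsilon> :: real
  assume "0 < \<epsilon>"
  then have e: "0 < \<epsilon> / 2" by simp
  obtain C where C: "0 < C"
    "\<And>x y. 0 < x \<Longrightarrow> x \<le> y \<Longrightarrow> ereal y < L \<Longrightarrow> \<phi> y \<le> C * (y / x) powr (\<rho> + \<epsilon> / 2) * \<phi> x"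
    "\<And>x y. 0 < x \<Longrightarrow> x \<le> y \<Longrightarrow> ereal y < L \<Longrightarrow> \<phi> x \<le> C * (y / x) powr (\<epsilon> / 2 - \<rho>) * \<phi> y"
    using regvar_bounds[OF assms(1) e] by blast
  obtain D where D: "0 < D"
    "\<And>x y. 0 < x \<Longrightarrow> x \<le> y \<Longrightarrow> ereal y < L \<Longrightarrow> \<psi> y \<le> D * (y / x) powr (\<sigma> + \<epsilon> / 2) * \<psi> x"
    "\<And>x y. 0 < x \<Longrightarrow> x \<le> y \<Longrightarrow> ereal y < L \<Longrightarrow> \<psi> x \<le> D * (y / x) powr (\<epsilon> / 2 - \<sigma>) * \<psi> y"
    using regvar_bounds[OF assms(2) e] by blast
  have "\<phi> y * \<psi> y \<le> (C * D) * (y / x) powr (\<rho> + \<sigma> + \<epsilon>) * (\<phi> x * \<psi> x) \<and>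
     \<phi> x * \<psi> x \<le> (C * D) * (y / x) powr (\<epsilon> - (\<rho> + \<sigma>)) * (\<phi> y * \<psi> y)"
    if xy: "0 < x" "x \<le> y" "ereal y < L" for x y
  proof -
    have x: "ereal x < L"
      using xy by (simp add: le_less_trans[of "ereal x" "ereal y"])
    have pos: "0 < \<phi> x" "0 < \<phi> y" "0 < \<psi> x" "0 < \<psi> y"
      using xy x assms[THEN regvar_pos] by auto
    have "\<phi> y * \<psi> y \<le> (C * (y / x) powr (\<rho> + \<epsilon> / 2) * \<phi> x) * (D * (y / x) powr (\<sigma> + \<epsilon> / 2) * \<psi> x)"
      using C D xy pos by (intro mult_mono) auto
    also have "\<dots> = (C * D) * ((y / x) powr (\<rho> + \<epsilon> / 2) * (y / x) powr (\<sigma> + \<epsilon> / 2)) * (\<phi> x * \<psi> x)"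
      by (simp only: mult_ac)
    also have "(y / x) powr (\<rho> + \<epsilon> / 2) * (y / x) powr (\<sigma> + \<epsilon> / 2) = (y / x) powr (\<rho> + \<sigma> + \<epsilon>)"
      by (simp flip: powr_add add: add_ac)
    finally have 1: "\<phi> y * \<psi> y \<le> (C * D) * (y / x) powr (\<rho> + \<sigma> + \<epsilon>) * (\<phi> x * \<psi> x)" .
    have "\<phi> x * \<psi> x \<le> (C * (y / x) powr (\<epsilon> / 2 - \<rho>) * \<phi> y) * (D * (y / x) powr (\<epsilon> / 2 - \<sigma>) * \<psi> y)"
      using C D xy pos by (intro mult_mono) auto
    also have "\<dots> = (C * D) * ((y / x) powr (\<epsilon> / 2 - \<rho>) * (y / x) powr (\<epsilon> / 2 - \<sigma>)) * (\<phi> y * \<psi> y)"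
      by (simp only: mult_ac)
    also have "(y / x) powr (\<epsilon> / 2 - \<rho>) * (y / x) powr (\<epsilon> / 2 - \<sigma>) = (y / x) powr (\<epsilon> - (\<rho> + \<sigma>))"
      by (subst powr_add[symmetric]) (simp add: algebra_simps)
    finally show ?thesis
      using 1 by blast
  qed
  then show "\<exists>C>0. \<forall>x y. 0 < x \<longrightarrow> x \<le> y \<longrightarrow> ereal y < L \<longrightarrow>
     \<phi> y * \<psi> y \<le> C * (y / x) powr (\<rho> + \<sigma> + \<epsilon>) * (\<phi> x * \<psi> x) \<and>
     \<phi> x * \<psi> x \<le> C * (y / x) powr (\<epsilon> - (\<rho> + \<sigma>)) * (\<phi> y * \<psi> y)"
    using C(1) D(1) by (intro exI[of _ "C * D"]) simp
qed

lemma regvar_inverse: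
  assumes "regvar L \<rho> \<phi>"
  shows "regvar L (- \<rho>) (\<lambda>u. inverse (\<phi> u))"
  unfolding regvar_def
proof (intro conjI allI impI ballI)
  show "(\<lambda>u. inverse (\<phi> u)) \<in> borel_measurable (lebesgue_on (einterval 0 L))"
    using assms[THEN regvar_measurable] by simp
  show "0 < inverse (\<phi> t)" if "t \<in> einterval 0 L" for t
    using that assms[THEN regvar_pos] by (simp add: einterval_iff)
  fix \<epsilon> :: real
  assume "0 < \<epsilon>"
  then obtain C where C: "0 < C"
    "\<And>x y. 0 < x \<Longrightarrow> x \<le> y \<Longrightarrow> ereal y < L \<Longrightarrow> \<phi> y \<le> C * (y / x) powr (\<rho> + \<epsilon>) * \<phi> x"
    "\<And>x y. 0 < x \<Longrightarrow> x \<le> y \<Longrightarrow> ereal y < L \<Longrightarrow> \<phi> x \<le> C * (y / x) powr (\<epsilon> - \<rho>) * \<phi> y"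
    using regvar_bounds[OF assms] by blast
  have "inverse (\<phi> y) \<le> C * (y / x) powr (- \<rho> + \<epsilon>) * inverse (\<phi> x) \<and>
     inverse (\<phi> x) \<le> C * (y / x) powr (\<epsilon> - - \<rho>) * inverse (\<phi> y)"
    if xy: "0 < x" "x \<le> y" "ereal y < L" for x y
  proof -
    have x: "ereal x < L"
      using xy by (simp add: le_less_trans[of "ereal x" "ereal y"])
    have pos: "0 < \<phi> x" "0 < \<phi> y"
      using xy x assms[THEN regvar_pos] by auto
    then show ?thesis
      using C(2,3)[OF xy] by (simp add: field_simps)
  qed
  then show "\<exists>C>0. \<forall>x y. 0 < x \<longrightarrow> x \<le> y \<longrightarrow> ereal y < L \<longrightarrow>
     inverse (\<phi> y) \<le> C * (y / x) powr (- \<rho> + \<epsilon>) * inverse (\<phi> x) \<and>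
     inverse (\<phi> x) \<le> C * (y / x) powr (\<epsilon> - - \<rho>) * inverse (\<phi> y)"
    using C(1) by blast
qed

lemma regvar_divide:
  "regvar L \<rho> \<phi> \<Longrightarrow> regvar L \<sigma> \<psi> \<Longrightarrow> regvar L (\<rho> - \<sigma>) (\<lambda>u. \<phi> u / \<psi> u)"
  using regvar_mult[OF _ regvar_inverse, of L \<rho> \<phi> \<sigma> \<psi>] by (simp add: divide_inverse)

text \<open>Passing from \<open>h x\<close> to \<open>g x\<close>, then to \<open>g y\<close>, and
  back to \<open>h y\<close> eliminates the comparison function at the price of
  \<open>C / c\<close>. The relation \<open>P\<close> stands for \<open>\<le>\<close> or its
  converse, which covers both conditions in \<open>SV\<close>.\<close>

lemma mono_ennreal_equivalent:
  assumes g: "\<And>x y. x \<in> S \<Longrightarrow> y \<in> S \<Longrightarrow> P x y \<Longrightarrow> g x \<le> (g y :: ennreal)"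
    and eq: "equivalent_on S (\<lambda>t. ennreal (h t)) g" and h: "\<And>x. x \<in> S \<Longrightarrow> 0 \<le> h x"
  obtains C where "0 < C" "\<And>x y. x \<in> S \<Longrightarrow> y \<in> S \<Longrightarrow> P x y \<Longrightarrow> h x \<le> C * h y"
proof -
  from eq obtain c C where cC: "0 < c" "c \<le> C"
    "\<And>x. x \<in> S \<Longrightarrow> ennreal c * g x \<le> ennreal (h x)" "\<And>x. x \<in> S \<Longrightarrow> ennreal (h x) \<le> ennreal C * g x"
    unfolding equivalent_on_def by blast
  have "h x \<le> (C / c) * h y" if xy: "x \<in> S" "y \<in> S" "P x y" for x y
  proof -
    have "ennreal (h x) \<le> ennreal C * g y"
      using cC(4)[OF xy(1)] g[OF xy] by (meson mult_left_mono order_trans zero_le)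
    also have "\<dots> = ennreal (C / c) * (ennreal c * g y)"
      using cC(1,2) by (simp flip: ennreal_mult mult.assoc)
    also have "\<dots> \<le> ennreal (C / c) * ennreal (h y)"
      using cC(3)[OF xy(2)] by (rule mult_left_mono) simp
    also have "\<dots> = ennreal ((C / c) * h y)"
      using cC(1,2) h[OF xy(2)] by (simp flip: ennreal_mult)
    finally show ?thesis
      using cC(1,2) h[OF xy(2)] by (subst (asm) ennreal_le_iff) auto
  qed
  with cC(1,2) show ?thesis
    by (intro that[of "C / c"]) auto
qed

text \<open>Almost monotonicity of \<open>t powr \<epsilon> * d t\<close> bounds \<open>d x\<close>
  by \<open>d y\<close> for \<open>x \<le> y\<close>; that of
  \<open>t powr (- \<epsilon>) * d t\<close> bounds \<open>d y\<close> by
  \<open>d x\<close>.\<close>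

lemma SV_regvar:
  assumes "d \<in> SV L"
  shows "regvar L 0 d"
  unfolding regvar_def
proof (intro conjI allI impI)
  show "d \<in> borel_measurable (lebesgue_on (einterval 0 L))" "\<forall>t\<in>einterval 0 L. 0 < d t"
    using assms by (auto simp: SV_def)
  then have pos: "0 \<le> d t" if "t \<in> einterval 0 L" for t
    using that by force
  fix \<epsilon> :: real
  assume "0 < \<epsilon>"
  with assms obtain g h where g: "mono_on (einterval 0 L) g"
      "equivalent_on (einterval 0 L) (\<lambda>t. ennreal (t powr \<epsilon> * d t)) g"
    and h: "antimono_on (einterval 0 L) h"
      "equivalent_on (einterval 0 L) (\<lambda>t. ennreal (t powr - \<epsilon> * d t)) h"
    unfolding SV_def by blast
  obtain C where C: "0 < C" "\<And>x y. x \<in> einterval 0 L \<Longrightarrow> y \<in> einterval 0 L \<Longrightarrow> x \<le> y \<Longrightarrow>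
      x powr \<epsilon> * d x \<le> C * (y powr \<epsilon> * d y)"
    by (rule mono_ennreal_equivalent[OF _ g(2), of "(\<le>)"]) (use g(1) pos in \<open>auto simp: monotone_on_def\<close>)
  obtain D where D: "0 < D" "\<And>x y. x \<in> einterval 0 L \<Longrightarrow> y \<in> einterval 0 L \<Longrightarrow> y \<le> x \<Longrightarrow>
      x powr - \<epsilon> * d x \<le> D * (y powr - \<epsilon> * d y)"
    by (rule mono_ennreal_equivalent[OF _ h(2), of "\<lambda>x y. y \<le> x"]) (use h(1) pos in \<open>auto simp: monotone_on_def\<close>)
  have "d y \<le> max C D * (y / x) powr (0 + \<epsilon>) * d x \<and> d x \<le> max C D * (y / x) powr (\<epsilon> - 0) * d y"
    if xy: "0 < x" "x \<le> y" "ereal y < L" for x y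
  proof -
    have x: "ereal x < L"
      using xy by (simp add: le_less_trans[of "ereal x" "ereal y"])
    have S: "x \<in> einterval 0 L" "y \<in> einterval 0 L"
      using xy x by (auto simp: einterval_iff)
    have "d y \<le> D * (y / x) powr \<epsilon> * d x"
      using D(2)[OF S(2,1) xy(2)] xy by (simp add: powr_minus powr_divide field_simps)
    also have "\<dots> \<le> max C D * (y / x) powr \<epsilon> * d x"
      using pos[OF S(1)] by (intro mult_right_mono) auto
    finally have 1: "d y \<le> max C D * (y / x) powr \<epsilon> * d x" .
    have "d x \<le> C * (y / x) powr \<epsilon> * d y"
      using C(2)[OF S xy(2)] xy by (simp add: powr_divide field_simps)
    also have "\<dots> \<le> max C D * (y / x) powr \<epsilon> * d y"
      using pos[OF S(2)] by (intro mult_right_mono) auto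
    finally show ?thesis
      using 1 by simp
  qed
  then show "\<exists>C>0. \<forall>x y. 0 < x \<longrightarrow> x \<le> y \<longrightarrow> ereal y < L \<longrightarrow>
      d y \<le> C * (y / x) powr (0 + \<epsilon>) * d x \<and> d x \<le> C * (y / x) powr (\<epsilon> - 0) * d y"
    using C(1) by (intro exI[of _ "max C D"]) auto
qed

section \<open>Hardy inequalities for non-increasing functions\<close>

lemma regvar_times_antimono_measurable:
  assumes "regvar L \<rho> \<phi>" "antimono g" "A \<subseteq> einterval 0 L"
  shows "(\<lambda>u. ennreal (\<phi> u) * g u) \<in> borel_measurable (lebesgue_on A)"
proof -
  have [measurable]: "\<phi> \<in> borel_measurable (lebesgue_on A)" "g \<in> borel_measurable (lebesgue_on A)"
    using measurable_subinterval[OF regvar_measurable[OF assms(1)] assms(3)]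
      borel_imp_lebesgue_on[OF antimono_ennreal_measurable[OF assms(2)]] by auto
  show ?thesis by measurable
qed

lemma ennreal_collect:
  "0 \<le> h \<Longrightarrow> 0 \<le> k \<Longrightarrow> 0 \<le> m \<Longrightarrow> ennreal h * ((ennreal k * Q) * ennreal m) = ennreal (h * k * m) * Q"
  by (simp add: ennreal_mult mult_ac)

text \<open>To the left of \<open>t\<close>, within a factor 2, \<open>g\<close> is at least
  \<open>g t\<close> and \<open>\<phi>\<close> is at least a multiple of \<open>\<phi> t\<close>.
  Hence the function is bounded below by a constant on an interval whose measure does not depend on
  \<open>t\<close>.\<close>

lemma regvar_antimono_le_haar_norm:
  assumes q: "0 < q" and \<phi>: "regvar L \<rho> \<phi>"
  obtains C where "0 < C"
    "\<And>g t. antimono g \<Longrightarrow> 0 < t \<Longrightarrow> ereal t < L \<Longrightarrow>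
       ennreal (\<phi> t) * g t \<le> ennreal C * haar_norm q (ereal (t / 2)) (ereal t) (\<lambda>w. ennreal (\<phi> w) * g w)"
proof -
  obtain A where A: "0 < A"
    "\<And>x y. 0 < x \<Longrightarrow> x \<le> y \<Longrightarrow> ereal y < L \<Longrightarrow> \<phi> y \<le> A * (y / x) powr (\<rho> + 1) * \<phi> x"
    using regvar_upper_bound[OF \<phi> zero_less_one] by blast
  obtain B where B: "0 < B"
    "\<And>x K. 0 < x \<Longrightarrow> K \<le> ennreal B * haar_norm q (ereal x) (ereal (2 * x)) (\<lambda>_. K)"
    using haar_norm_const_ge[OF q] by blast
  \<comment> \<open>The exponent \<open>\<rho> + 1\<close> of the bound with
    \<open>\<epsilon> = 1\<close> may be negative; since \<open>1 \<le> t / w \<le> 2\<close>, its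
    absolute value works in either case.\<close>
  define D where "D = A * 2 powr \<bar>\<rho> + 1\<bar>"
  have D: "0 < D"
    using A by (simp add: D_def)
  have "ennreal (\<phi> t) * g t \<le> ennreal (B * D) * haar_norm q (ereal (t / 2)) (ereal t) (\<lambda>w. ennreal (\<phi> w) * g w)"
    if g: "antimono g" and t: "0 < t" "ereal t < L" for g t
  proof -
    have sub: "einterval (ereal (t / 2)) (ereal t) \<subseteq> einterval 0 L"
      using t by (intro einterval_mono) auto
    have "haar_norm q (ereal (t / 2)) (ereal t) (\<lambda>_. ennreal (\<phi> t) * g t)
      \<le> ennreal D * haar_norm q (ereal (t / 2)) (ereal t) (\<lambda>w. ennreal (\<phi> w) * g w)"
    proof (rule haar_norm_le[OF q _ _ regvar_times_antimono_measurable[OF \<phi> g sub]])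
      fix w
      assume "w \<in> einterval (ereal (t / 2)) (ereal t)"
      then have w: "t / 2 < w" "w < t"
        by auto
      with t have w0: "0 < w" "1 \<le> t / w" "t / w \<le> 2"
        by (auto simp: field_simps)
      have \<phi>w: "0 < \<phi> w"
        using regvar_pos[OF \<phi>, of w] w w0 t less_trans[of "ereal w" "ereal t" L] by simp
      have "\<phi> t \<le> A * (t / w) powr (\<rho> + 1) * \<phi> w"
        using A(2)[of w t] w w0 t by simp
      also have "(t / w) powr (\<rho> + 1) \<le> (t / w) powr \<bar>\<rho> + 1\<bar>"
        using w0 by (intro powr_mono) auto
      also have "\<dots> \<le> 2 powr \<bar>\<rho> + 1\<bar>"
        using w0 by (intro powr_mono2) auto
      finally have "\<phi> t \<le> D * \<phi> w"
        using A(1) \<phi>w by (simp add: D_def)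
      then have "ennreal (\<phi> t) * g t \<le> ennreal (D * \<phi> w) * g w"
        using g w by (intro mult_mono ennreal_leI) (auto simp: antimono_def)
      then show "ennreal (\<phi> t) * g t \<le> ennreal D * (ennreal (\<phi> w) * g w)"
        using D \<phi>w by (simp add: ennreal_mult mult.assoc)
    qed (use t in auto)
    then have "ennreal B * haar_norm q (ereal (t / 2)) (ereal t) (\<lambda>_. ennreal (\<phi> t) * g t)
       \<le> ennreal B * (ennreal D * haar_norm q (ereal (t / 2)) (ereal t) (\<lambda>w. ennreal (\<phi> w) * g w))"
      by (rule mult_left_mono) simp
    with B(2)[of "t / 2" "ennreal (\<phi> t) * g t"] t show ?thesis
      using B(1) D by (simp add: ennreal_mult mult.assoc)
  qed
  with B(1) D show ?thesis
    by (intro that[of "B * D"]) auto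
qed

text \<open>For fixed \<open>u\<close> the \<open>W\<close>-norm is bounded by
  \<open>u powr - e\<close> times a \<open>q\<close>-norm over \<open>(0, u)\<close>, up to the
  factor \<open>\<psi> u / \<phi> u\<close>. This leaves a Hardy inequality in which both exponents
  are \<open>q\<close>.\<close>

lemma haar_norm_antimono_Hardy_lower:
  assumes q: "0 < q" and W: "0 < W" and \<phi>: "regvar L \<alpha> \<phi>" and \<psi>: "regvar L \<beta> \<psi>" and less: "\<alpha> < \<beta>"
  obtains C where "0 < C"
    "\<And>g T. antimono g \<Longrightarrow> T \<le> L \<Longrightarrow>
       haar_norm q 0 T (\<lambda>u. ennreal (\<phi> u / \<psi> u) * haar_norm W 0 (ereal u) (\<lambda>v. ennreal (\<psi> v) * g v))
       \<le> ennreal C * haar_norm q 0 T (\<lambda>u. ennreal (\<phi> u) * g u)"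
proof -
  define e where "e = (\<beta> - \<alpha>) / 4"
  have e: "0 < e" and e2: "0 < 2 * e"
    using less by (simp_all add: e_def)
  have "\<alpha> - \<beta> = - 4 * e"
    by (simp add: e_def)
  then have \<chi>: "regvar L (- 4 * e) (\<lambda>u. \<phi> u / \<psi> u)"
    using regvar_divide[OF \<phi> \<psi>] by simp
  have \<phi>e: "regvar L (e + \<alpha>) (\<lambda>u. u powr e * \<phi> u)"
    by (intro regvar_mult regvar_powr \<phi>)
  obtain A where A: "0 < A"
    "\<And>x y. 0 < x \<Longrightarrow> x \<le> y \<Longrightarrow> ereal y < L \<Longrightarrow> \<phi> y / \<psi> y \<le> A * (y / x) powr (- 4 * e + e) * (\<phi> x / \<psi> x)"
    using regvar_upper_bound[OF \<chi> e] by blast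
  obtain B where B: "0 < B"
    "\<And>g t. antimono g \<Longrightarrow> 0 < t \<Longrightarrow> ereal t < L \<Longrightarrow> ennreal (t powr e * \<phi> t) * g t
       \<le> ennreal B * haar_norm q (ereal (t / 2)) (ereal t) (\<lambda>w. ennreal (w powr e * \<phi> w) * g w)"
    using regvar_antimono_le_haar_norm[OF q \<phi>e] by blast
  obtain D where D: "0 < D"
    "\<And>c. 0 < c \<Longrightarrow> haar_norm W 0 (ereal c) (\<lambda>u. ennreal (u powr (2 * e))) \<le> ennreal (D * c powr (2 * e))"
    using haar_norm_powr_from_0_le[OF W e2] by blast
  obtain H where H: "0 < H"
    "\<And>T G. G \<in> borel_measurable (lebesgue_on (einterval 0 T)) \<Longrightarrow>
      haar_norm q 0 T (\<lambda>u. ennreal (u powr - e) * haar_norm q 0 (ereal u) (\<lambda>w. ennreal (w powr e) * G w))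
      \<le> ennreal H * haar_norm q 0 T G"
    using haar_norm_Hardy_lower[OF q e] by blast
  have "haar_norm q 0 T (\<lambda>u. ennreal (\<phi> u / \<psi> u) * haar_norm W 0 (ereal u) (\<lambda>v. ennreal (\<psi> v) * g v))
       \<le> ennreal (A * B * D * H) * haar_norm q 0 T (\<lambda>u. ennreal (\<phi> u) * g u)"
    if g: "antimono g" and T: "T \<le> L" for g T
  proof -
    have sub: "einterval 0 T \<subseteq> einterval 0 L"
      using T by (intro einterval_mono) auto
    \<comment> \<open>The bound at a point \<open>v\<close> needs only \<open>(v/2, v)\<close>.
      Enlarging this to \<open>(0, u)\<close> makes \<open>Q u\<close> a common bound for all
      \<open>v < u\<close>, which can be taken out of the \<open>W\<close>-norm.\<close>
    define Q where "Q = (\<lambda>u. haar_norm q 0 (ereal u) (\<lambda>w. ennreal (w powr e * \<phi> w) * g w))"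
    have Q': "Q u = haar_norm q 0 (ereal u) (\<lambda>w. ennreal (w powr e) * (ennreal (\<phi> w) * g w))" for u
      unfolding Q_def by (intro arg_cong[where f = "haar_norm q 0 (ereal u)"] ext) (simp add: ennreal_mult' mult.assoc)
    have Q_meas [measurable]: "Q \<in> borel_measurable (lebesgue_on S)" for S
      unfolding Q_def by (intro borel_imp_lebesgue_on haar_norm_lower_measurable q)
    have [measurable]: "(\<lambda>u. haar_norm W 0 (ereal u) (\<lambda>v. ennreal (\<psi> v) * g v)) \<in> borel_measurable (lebesgue_on S)" for S
      by (intro borel_imp_lebesgue_on haar_norm_lower_measurable W)
    have [measurable]: "(\<lambda>u. \<phi> u / \<psi> u) \<in> borel_measurable (lebesgue_on (einterval 0 T))"
      by (rule measurable_subinterval[OF regvar_measurable[OF \<chi>] sub])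
    have pointwise: "ennreal (\<phi> u / \<psi> u) * haar_norm W 0 (ereal u) (\<lambda>v. ennreal (\<psi> v) * g v)
       \<le> ennreal (A * B * D) * (ennreal (u powr - e) * Q u)" if "u \<in> einterval 0 T" for u
    proof -
      have u: "0 < u" "ereal u < L"
        using that sub by (auto simp: einterval_iff)
      have pos: "0 < \<phi> u" "0 < \<psi> u"
        using regvar_pos[OF \<phi>] regvar_pos[OF \<psi>] u by simp_all
      \<comment> \<open>\<open>k\<close> gathers what depends on \<open>u\<close> alone: the
        comparison of \<open>\<phi> / \<psi>\<close> at \<open>v\<close> and \<open>u\<close> reads
        \<open>\<psi> v \<le> k * v powr (3 * e) * \<phi> v\<close>.\<close>
      define k where "k = \<psi> u / \<phi> u * A * u powr (- 3 * e)"
      have k: "0 < k"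
        using pos A u by (simp add: k_def)
      have usub: "einterval 0 (ereal u) \<subseteq> einterval 0 L"
        using u by (intro einterval_mono) auto
      have "haar_norm W 0 (ereal u) (\<lambda>v. ennreal (\<psi> v) * g v)
        \<le> (ennreal (k * B) * Q u) * haar_norm W 0 (ereal u) (\<lambda>v. ennreal (v powr (2 * e)))"
      proof (rule haar_norm_le[OF W _ regvar_times_antimono_measurable[OF \<psi> g usub]])
        fix v
        assume "v \<in> einterval 0 (ereal u)"
        then have v: "0 < v" "v < u"
          by (auto simp: einterval_iff)
        then have vL: "ereal v < L"
          using u less_trans[of "ereal v" "ereal u" L] by simp
        have vpos: "0 < \<phi> v" "0 < \<psi> v"
          using regvar_pos[OF \<phi>] regvar_pos[OF \<psi>] v vL by simp_all
        have "\<phi> u / \<psi> u \<le> A * (u / v) powr (- 3 * e) * (\<phi> v / \<psi> v)"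
          using A(2)[of v u] v u by simp
        then have "\<psi> v \<le> \<psi> u / \<phi> u * A * (u / v) powr (- 3 * e) * \<phi> v"
          using pos vpos by (simp add: divide_simps) (simp add: mult_ac)
        \<comment> \<open>Of \<open>3 * e\<close>, the part \<open>2 * e\<close> is kept for the
          \<open>W\<close>-norm over \<open>(0, u)\<close>, and \<open>v powr e * \<phi> v\<close>
          is the weight inside \<open>Q\<close>.\<close>
        also have "(u / v) powr (- 3 * e) = u powr (- 3 * e) * (v powr (2 * e) * v powr e)"
        proof -
          have "v powr (2 * e) * v powr e = inverse (v powr (- 3 * e))"
            unfolding powr_add[symmetric] powr_minus[symmetric] by simp
          then show ?thesis
            using u v by (subst powr_divide) (simp_all add: divide_inverse)
        qed
        also have "\<psi> u / \<phi> u * A * (u powr (- 3 * e) * (v powr (2 * e) * v powr e)) * \<phi> v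
           = k * v powr (2 * e) * (v powr e * \<phi> v)"
          by (simp add: k_def)
        finally have "ennreal (\<psi> v) * g v \<le> ennreal (k * v powr (2 * e) * (v powr e * \<phi> v)) * g v"
          by (intro mult_right_mono ennreal_leI) auto
        also have "\<dots> = ennreal (k * v powr (2 * e)) * (ennreal (v powr e * \<phi> v) * g v)"
          using k vpos by (simp add: ennreal_mult mult.assoc)
        also have "\<dots> \<le> ennreal (k * v powr (2 * e)) * (ennreal B * Q u)"
        proof (rule mult_left_mono)
          have "haar_norm q (ereal (v / 2)) (ereal v) (\<lambda>w. ennreal (w powr e * \<phi> w) * g w) \<le> Q u"
            unfolding Q_def using v by (intro haar_norm_subset[OF q] einterval_mono) auto
          then have "ennreal B * haar_norm q (ereal (v / 2)) (ereal v) (\<lambda>w. ennreal (w powr e * \<phi> w) * g w) \<le> ennreal B * Q u"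
            by (rule mult_left_mono) simp
          with B(2)[OF g v(1) vL] show "ennreal (v powr e * \<phi> v) * g v \<le> ennreal B * Q u"
            by (rule order_trans)
        qed simp
        also have "\<dots> = (ennreal (k * B) * Q u) * ennreal (v powr (2 * e))"
          using k B(1) by (simp add: ennreal_mult mult_ac)
        finally show "ennreal (\<psi> v) * g v \<le> (ennreal (k * B) * Q u) * ennreal (v powr (2 * e))" .
      qed auto
      also have "\<dots> \<le> (ennreal (k * B) * Q u) * ennreal (D * u powr (2 * e))"
        using D(2)[OF u(1)] by (rule mult_left_mono) simp
      finally have "ennreal (\<phi> u / \<psi> u) * haar_norm W 0 (ereal u) (\<lambda>v. ennreal (\<psi> v) * g v)
         \<le> ennreal (\<phi> u / \<psi> u) * ((ennreal (k * B) * Q u) * ennreal (D * u powr (2 * e)))"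
        by (rule mult_left_mono) simp
      also have "\<dots> = ennreal (\<phi> u / \<psi> u * (k * B) * (D * u powr (2 * e))) * Q u"
        using pos k B(1) D(1) by (intro ennreal_collect) auto
      also have "\<phi> u / \<psi> u * (k * B) * (D * u powr (2 * e)) = (A * B * D) * (u powr (- 3 * e) * u powr (2 * e))"
        using pos by (simp add: k_def)
      also have "u powr (- 3 * e) * u powr (2 * e) = u powr - e"
        by (simp flip: powr_add)
      finally show ?thesis
        using A(1) B(1) D(1) by (simp add: ennreal_mult mult.assoc)
    qed
    have "haar_norm q 0 T (\<lambda>u. ennreal (\<phi> u / \<psi> u) * haar_norm W 0 (ereal u) (\<lambda>v. ennreal (\<psi> v) * g v))
       \<le> ennreal (A * B * D) * haar_norm q 0 T (\<lambda>u. ennreal (u powr - e) * Q u)"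
      by (rule haar_norm_le[OF q _ _ _ pointwise]) auto
    also have "\<dots> \<le> ennreal (A * B * D) * (ennreal H * haar_norm q 0 T (\<lambda>u. ennreal (\<phi> u) * g u))"
      unfolding Q' by (intro mult_left_mono H(2) regvar_times_antimono_measurable[OF \<phi> g sub]) simp
    finally show ?thesis
      using A(1) B(1) D(1) H(1) by (simp add: ennreal_mult mult.assoc)
  qed
  with A(1) B(1) D(1) H(1) show ?thesis
    by (intro that[of "A * B * D * H"]) auto
qed

text \<open>The signs of the powers are reversed: the positive index of
  \<open>\<phi> / \<psi>\<close> leaves negative powers of \<open>v\<close>, whose
  \<open>W\<close>-norm is finite at infinity.\<close>

lemma haar_norm_antimono_Hardy_upper:
  assumes q: "0 < q" and W: "0 < W" and \<phi>: "regvar L \<alpha> \<phi>" and \<psi>: "regvar L \<beta> \<psi>" and less: "\<beta> < \<alpha>"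
  obtains C where "0 < C"
    "\<And>g T. antimono g \<Longrightarrow> T \<le> L \<Longrightarrow>
       haar_norm q 0 T (\<lambda>u. ennreal (\<phi> u / \<psi> u) * haar_norm W (ereal u) T (\<lambda>v. ennreal (\<psi> v) * g v))
       \<le> ennreal C * haar_norm q 0 T (\<lambda>u. ennreal (\<phi> u) * g u)"
proof -
  define e where "e = (\<alpha> - \<beta>) / 4"
  have e: "0 < e" and e2: "0 < 2 * e"
    using less by (simp_all add: e_def)
  have "\<alpha> - \<beta> = 4 * e"
    by (simp add: e_def)
  then have \<chi>: "regvar L (4 * e) (\<lambda>u. \<phi> u / \<psi> u)"
    using regvar_divide[OF \<phi> \<psi>] by simp
  have \<phi>e: "regvar L (- e + \<alpha>) (\<lambda>u. u powr - e * \<phi> u)"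
    by (intro regvar_mult regvar_powr \<phi>)
  obtain A where A: "0 < A"
    "\<And>x y. 0 < x \<Longrightarrow> x \<le> y \<Longrightarrow> ereal y < L \<Longrightarrow> \<phi> x / \<psi> x \<le> A * (y / x) powr (e - 4 * e) * (\<phi> y / \<psi> y)"
    using regvar_lower_bound[OF \<chi> e] by blast
  obtain B where B: "0 < B"
    "\<And>g t. antimono g \<Longrightarrow> 0 < t \<Longrightarrow> ereal t < L \<Longrightarrow> ennreal (t powr - e * \<phi> t) * g t
       \<le> ennreal B * haar_norm q (ereal (t / 2)) (ereal t) (\<lambda>w. ennreal (w powr - e * \<phi> w) * g w)"
    using regvar_antimono_le_haar_norm[OF q \<phi>e] by blast
  obtain D where D: "0 < D"
    "\<And>c. 0 < c \<Longrightarrow> haar_norm W (ereal c) \<infinity> (\<lambda>u. ennreal (u powr - (2 * e))) \<le> ennreal (D * c powr - (2 * e))"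
    using haar_norm_powr_to_inf_le[OF W e2] by blast
  obtain H where H: "0 < H"
    "\<And>T G. G \<in> borel_measurable (lebesgue_on (einterval 0 T)) \<Longrightarrow>
      haar_norm q 0 T (\<lambda>u. ennreal (u powr e) * haar_norm q (ereal (u / 2)) T (\<lambda>w. ennreal (w powr - e) * G w))
      \<le> ennreal H * haar_norm q 0 T G"
    using haar_norm_Hardy_upper[OF q e] by blast
  have "haar_norm q 0 T (\<lambda>u. ennreal (\<phi> u / \<psi> u) * haar_norm W (ereal u) T (\<lambda>v. ennreal (\<psi> v) * g v))
       \<le> ennreal (A * B * D * H) * haar_norm q 0 T (\<lambda>u. ennreal (\<phi> u) * g u)"
    if g: "antimono g" and T: "T \<le> L" for g T
  proof -
    have sub: "einterval 0 T \<subseteq> einterval 0 L"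
      using T by (intro einterval_mono) auto
    \<comment> \<open>For \<open>v\<close> just above \<open>u\<close> the interval
      \<open>(v/2, v)\<close> reaches below \<open>u\<close>, but not below
      \<open>u / 2\<close>.\<close>
    define Q where "Q = (\<lambda>u. haar_norm q (ereal (u / 2)) T (\<lambda>w. ennreal (w powr - e * \<phi> w) * g w))"
    have Q': "Q u = haar_norm q (ereal (u / 2)) T (\<lambda>w. ennreal (w powr - e) * (ennreal (\<phi> w) * g w))" for u
      unfolding Q_def by (intro arg_cong[where f = "haar_norm q (ereal (u / 2)) T"] ext) (simp add: ennreal_mult' mult.assoc)
    have Q_meas [measurable]: "Q \<in> borel_measurable (lebesgue_on S)" for S
      unfolding Q_def by (intro borel_imp_lebesgue_on haar_norm_upper_measurable q) simp
    have [measurable]: "(\<lambda>u. haar_norm W (ereal u) T (\<lambda>v. ennreal (\<psi> v) * g v)) \<in> borel_measurable (lebesgue_on S)" for S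
      using haar_norm_upper_measurable[OF W, of 1] by (intro borel_imp_lebesgue_on) simp
    have [measurable]: "(\<lambda>u. \<phi> u / \<psi> u) \<in> borel_measurable (lebesgue_on (einterval 0 T))"
      by (rule measurable_subinterval[OF regvar_measurable[OF \<chi>] sub])
    have pointwise: "ennreal (\<phi> u / \<psi> u) * haar_norm W (ereal u) T (\<lambda>v. ennreal (\<psi> v) * g v)
       \<le> ennreal (A * B * D) * (ennreal (u powr e) * Q u)" if "u \<in> einterval 0 T" for u
    proof -
      have u: "0 < u" "ereal u < L"
        using that sub by (auto simp: einterval_iff)
      have pos: "0 < \<phi> u" "0 < \<psi> u"
        using regvar_pos[OF \<phi>] regvar_pos[OF \<psi>] u by simp_all
      define k where "k = \<psi> u / \<phi> u * A * u powr (3 * e)"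
      have k: "0 < k"
        using pos A u by (simp add: k_def)
      have usub: "einterval (ereal u) T \<subseteq> einterval 0 L"
        using u T by (intro einterval_mono) auto
      have "haar_norm W (ereal u) T (\<lambda>v. ennreal (\<psi> v) * g v)
        \<le> (ennreal (k * B) * Q u) * haar_norm W (ereal u) T (\<lambda>v. ennreal (v powr - (2 * e)))"
      proof (rule haar_norm_le[OF W _ regvar_times_antimono_measurable[OF \<psi> g usub]])
        fix v
        assume v_in: "v \<in> einterval (ereal u) T"
        then have v: "0 < v" "u < v" "ereal v < T"
          using u by (auto simp: einterval_iff)
        then have vL: "ereal v < L"
          using T by order
        have vpos: "0 < \<phi> v" "0 < \<psi> v"
          using regvar_pos[OF \<phi>] regvar_pos[OF \<psi>] v vL by simp_all
        have "\<phi> u / \<psi> u \<le> A * (v / u) powr (- 3 * e) * (\<phi> v / \<psi> v)"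
          using A(2)[of u v] v u vL by simp
        then have "\<psi> v \<le> \<psi> u / \<phi> u * A * (v / u) powr (- 3 * e) * \<phi> v"
          using pos vpos by (simp add: divide_simps) (simp add: mult_ac)
        also have "(v / u) powr (- 3 * e) = u powr (3 * e) * (v powr - (2 * e) * v powr - e)"
        proof -
          have "v powr - (2 * e) * v powr - e = v powr (- 3 * e)"
            unfolding powr_add[symmetric] by simp
          moreover have "u powr (3 * e) = inverse (u powr (- 3 * e))"
            unfolding powr_minus[symmetric] by simp
          ultimately show ?thesis
            using u v by (subst powr_divide) (simp_all add: divide_inverse)
        qed
        also have "\<psi> u / \<phi> u * A * (u powr (3 * e) * (v powr - (2 * e) * v powr - e)) * \<phi> v
           = k * v powr - (2 * e) * (v powr - e * \<phi> v)"
          by (simp add: k_def)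
        finally have "ennreal (\<psi> v) * g v \<le> ennreal (k * v powr - (2 * e) * (v powr - e * \<phi> v)) * g v"
          by (intro mult_right_mono ennreal_leI) auto
        also have "\<dots> = ennreal (k * v powr - (2 * e)) * (ennreal (v powr - e * \<phi> v) * g v)"
          using k vpos by (simp add: ennreal_mult mult.assoc)
        also have "\<dots> \<le> ennreal (k * v powr - (2 * e)) * (ennreal B * Q u)"
        proof (rule mult_left_mono)
          have "haar_norm q (ereal (v / 2)) (ereal v) (\<lambda>w. ennreal (w powr - e * \<phi> w) * g w) \<le> Q u"
            unfolding Q_def using v by (intro haar_norm_subset[OF q] einterval_mono) auto
          then have "ennreal B * haar_norm q (ereal (v / 2)) (ereal v) (\<lambda>w. ennreal (w powr - e * \<phi> w) * g w) \<le> ennreal B * Q u"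
            by (rule mult_left_mono) simp
          with B(2)[OF g v(1) vL] show "ennreal (v powr - e * \<phi> v) * g v \<le> ennreal B * Q u"
            by (rule order_trans)
        qed simp
        also have "\<dots> = (ennreal (k * B) * Q u) * ennreal (v powr - (2 * e))"
          using k B(1) by (simp add: ennreal_mult mult_ac)
        finally show "ennreal (\<psi> v) * g v \<le> (ennreal (k * B) * Q u) * ennreal (v powr - (2 * e))" .
      qed (use u in auto)
      also have "\<dots> \<le> (ennreal (k * B) * Q u) * ennreal (D * u powr - (2 * e))"
      proof (rule mult_left_mono)
        \<comment> \<open>Replacing \<open>T\<close> by \<open>\<infinity>\<close> only enlarges the
          norm and keeps the constant independent of \<open>T\<close>.\<close>
        have "haar_norm W (ereal u) T (\<lambda>v. ennreal (v powr - (2 * e))) \<le> haar_norm W (ereal u) \<infinity> (\<lambda>v. ennreal (v powr - (2 * e)))"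
          by (intro haar_norm_subset[OF W] einterval_mono) auto
        with D(2)[OF u(1)] show "haar_norm W (ereal u) T (\<lambda>v. ennreal (v powr - (2 * e))) \<le> ennreal (D * u powr - (2 * e))"
          by order
      qed simp
      finally have "ennreal (\<phi> u / \<psi> u) * haar_norm W (ereal u) T (\<lambda>v. ennreal (\<psi> v) * g v)
         \<le> ennreal (\<phi> u / \<psi> u) * ((ennreal (k * B) * Q u) * ennreal (D * u powr - (2 * e)))"
        by (rule mult_left_mono) simp
      also have "\<dots> = ennreal (\<phi> u / \<psi> u * (k * B) * (D * u powr - (2 * e))) * Q u"
        using pos k B(1) D(1) by (intro ennreal_collect) auto
      also have "\<phi> u / \<psi> u * (k * B) * (D * u powr - (2 * e)) = (A * B * D) * (u powr (3 * e) * u powr - (2 * e))"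
        using pos by (simp add: k_def)
      also have "u powr (3 * e) * u powr - (2 * e) = u powr e"
        by (simp flip: powr_add)
      finally show ?thesis
        using A(1) B(1) D(1) by (simp add: ennreal_mult mult.assoc)
    qed
    have "haar_norm q 0 T (\<lambda>u. ennreal (\<phi> u / \<psi> u) * haar_norm W (ereal u) T (\<lambda>v. ennreal (\<psi> v) * g v))
       \<le> ennreal (A * B * D) * haar_norm q 0 T (\<lambda>u. ennreal (u powr e) * Q u)"
      by (rule haar_norm_le[OF q _ _ _ pointwise]) auto
    also have "\<dots> \<le> ennreal (A * B * D) * (ennreal H * haar_norm q 0 T (\<lambda>u. ennreal (\<phi> u) * g u))"
      unfolding Q' by (intro mult_left_mono H(2) regvar_times_antimono_measurable[OF \<phi> g sub]) simp
    finally show ?thesis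
      using A(1) B(1) D(1) H(1) by (simp add: ennreal_mult mult.assoc)
  qed
  with A(1) B(1) D(1) H(1) show ?thesis
    by (intro that[of "A * B * D * H"]) auto
qed

text \<open>The weights are known to be positive only inside the interval, so cancellations in
  \<open>\<phi> / \<psi>\<close> are available only there. Equality on the interval transfers
  non-measurability as well, so that \<open>esssup\<close> agrees for arbitrary functions.\<close>

lemma haar_norm_cong:
  assumes "\<And>u. u \<in> einterval x y \<Longrightarrow> G u = G' u"
  shows "haar_norm q x y G = haar_norm q x y G'"
proof -
  let ?M = "lebesgue_on (einterval x y)"
  let ?F = "\<lambda>G u. ennreal (u powr - recip q) * G u"
  have eq: "?F G u = ?F G' u" if "u \<in> space ?M" for u
    using assms[of u] that by simp
  have "?F G \<in> borel_measurable ?M \<longleftrightarrow> ?F G' \<in> borel_measurable ?M"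
    by (rule measurable_cong) (rule eq)
  then have "esssup ?M (?F G) = esssup ?M (?F G')"
    using eq by (cases "?F G \<in> borel_measurable ?M") (auto simp: esssup_non_measurable intro!: esssup_AE_cong AE_I2)
  moreover have "(\<integral>\<^sup>+u. epowr (?F G u) s \<partial>?M) = (\<integral>\<^sup>+u. epowr (?F G' u) s \<partial>?M)" for s
    by (rule nn_integral_cong) (simp only: eq)
  ultimately show ?thesis
    by (simp only: haar_norm_def lebesgue_norm_def)
qed

text \<open>Half of the positive index is given up in comparing \<open>\<phi> u\<close> with
  \<open>\<phi> t\<close>; the other half remains as a positive power of \<open>u\<close>, whose
  norm over \<open>(0, t)\<close> is finite.\<close>

lemma haar_norm_regvar_le:
  assumes q: "0 < q" and \<phi>: "regvar L \<rho> \<phi>" and \<rho>: "0 < \<rho>"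
  obtains C where "0 < C"
    "\<And>t. 0 < t \<Longrightarrow> ereal t < L \<Longrightarrow> haar_norm q 0 (ereal t) (\<lambda>u. ennreal (\<phi> u)) \<le> ennreal (C * \<phi> t)"
proof -
  define e where "e = \<rho> / 2"
  have e: "0 < e" and \<rho>e: "\<rho> = 2 * e"
    using \<rho> by (simp_all add: e_def)
  obtain A where A: "0 < A"
    "\<And>x y. 0 < x \<Longrightarrow> x \<le> y \<Longrightarrow> ereal y < L \<Longrightarrow> \<phi> x \<le> A * (y / x) powr (e - \<rho>) * \<phi> y"
    using regvar_lower_bound[OF \<phi> e] by blast
  obtain D where D: "0 < D"
    "\<And>c. 0 < c \<Longrightarrow> haar_norm q 0 (ereal c) (\<lambda>u. ennreal (u powr e)) \<le> ennreal (D * c powr e)"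
    using haar_norm_powr_from_0_le[OF q e] by blast
  have "haar_norm q 0 (ereal t) (\<lambda>u. ennreal (\<phi> u)) \<le> ennreal (A * D * \<phi> t)"
    if t: "0 < t" "ereal t < L" for t
  proof -
    have sub: "einterval 0 (ereal t) \<subseteq> einterval 0 L"
      using t by (intro einterval_mono) auto
    have [measurable]: "\<phi> \<in> borel_measurable (lebesgue_on (einterval 0 (ereal t)))"
      by (rule measurable_subinterval[OF regvar_measurable[OF \<phi>] sub])
    have pos: "0 < \<phi> t"
      using regvar_pos[OF \<phi>] t by auto
    have "haar_norm q 0 (ereal t) (\<lambda>u. ennreal (\<phi> u))
       \<le> ennreal (A * t powr - e * \<phi> t) * haar_norm q 0 (ereal t) (\<lambda>u. ennreal (u powr e))"
    proof (rule haar_norm_le[OF q])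
      fix u
      assume "u \<in> einterval 0 (ereal t)"
      then have u: "0 < u" "u < t"
        by (auto simp: einterval_iff)
      then have "\<phi> u \<le> A * (t / u) powr - e * \<phi> t"
        using A(2)[of u t] t by (simp add: \<rho>e)
      also have "\<dots> = (A * t powr - e * \<phi> t) * u powr e"
        using u t by (simp add: powr_divide powr_minus field_simps)
      finally show "ennreal (\<phi> u) \<le> ennreal (A * t powr - e * \<phi> t) * ennreal (u powr e)"
        using A(1) pos by (simp add: ennreal_leI flip: ennreal_mult)
    qed auto
    also have "\<dots> \<le> ennreal (A * t powr - e * \<phi> t) * ennreal (D * t powr e)"
      using D(2)[OF t(1)] by (rule mult_left_mono) simp
    also have "\<dots> = ennreal ((A * t powr - e * \<phi> t) * (D * t powr e))"
      using A(1) D(1) pos by (simp flip: ennreal_mult)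
    also have "(A * t powr - e * \<phi> t) * (D * t powr e) = A * D * \<phi> t"
      using t by (simp add: powr_minus)
    finally show ?thesis .
  qed
  with A(1) D(1) show ?thesis
    by (intro that[of "A * D"]) auto
qed

section \<open>The averaging operators\<close>

text \<open>Negative arguments are included, since \<open>ennreal t\<close> is 0 there. Hence
  \<open>antimono\<close> on the whole line can be the hypothesis of the Hardy inequalities.\<close>

lemma antimono_rearrangement: "antimono (rearrangement L f)"
proof (rule antimonoI)
  fix s t :: real
  assume "s \<le> t"
  then show "rearrangement L f t \<le> rearrangement L f s"
    unfolding rearrangement_def by (intro Inf_superset_mono) (auto dest: ennreal_leI intro: order_trans)
qed

text \<open>This is \<open>B_norm\<close> over \<open>du/u\<close>: the factor
  \<open>t powr (- recip r)\<close> is absorbed by the outer norm, \<open>u powr (- recip q)\<close>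
  by the inner one, and \<open>p\<close> survives only as the index of
  \<open>\<phi>\<close>.\<close>

definition iter_norm where
  "iter_norm L r b q \<phi> g = haar_norm r 0 L (\<lambda>t. ennreal (b t) * haar_norm q 0 (ereal t) (\<lambda>u. ennreal (\<phi> u) * g u))"

lemma B_norm_eq_iter_norm: "B_norm L p r b q a g = iter_norm L r b q (\<lambda>u. u powr recip p * a u) g"
proof -
  have "ennreal (u powr (recip p - recip q) * a u) * g u =
    ennreal (u powr - recip q) * (ennreal (u powr recip p * a u) * g u)" for u
  proof -
    have "u powr (recip p - recip q) * a u = u powr - recip q * (u powr recip p * a u)"
      by (simp flip: powr_add)
    then show ?thesis
      by (simp only: ennreal_mult' powr_ge_zero mult.assoc)
  qed
  then show ?thesis
    by (simp add: B_norm_def iter_norm_def haar_norm_def ennreal_mult' mult.assoc)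
qed

lemma haar_norm_weight_eq:
  "lebesgue_norm W x y (\<lambda>v. ennreal (v powr (k - recip W) * d v) * g v) =
   haar_norm W x y (\<lambda>v. ennreal (v powr k * d v) * g v)"
proof -
  have "ennreal (v powr (k - recip W) * d v) * g v =
    ennreal (v powr - recip W) * (ennreal (v powr k * d v) * g v)" for v
  proof -
    have "v powr (k - recip W) * d v = v powr - recip W * (v powr k * d v)"
      by (simp flip: powr_add)
    then show ?thesis
      by (simp only: ennreal_mult' powr_ge_zero mult.assoc)
  qed
  then show ?thesis
    by (simp add: haar_norm_def)
qed

text \<open>The constant \<open>c\<close> is the same for all \<open>t\<close>. The inner norms are
  increasing in \<open>t\<close>, hence measurable for arbitrary \<open>G\<close> and
  \<open>G'\<close>.\<close>

lemma iter_norm_le: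
  assumes q: "0 < q" and r: "0 < r" and b: "regvar L \<sigma> b"
    and le: "\<And>t. t \<in> einterval 0 L \<Longrightarrow> haar_norm q 0 (ereal t) (\<lambda>u. ennreal (\<phi> u) * G u)
       \<le> c * haar_norm q 0 (ereal t) (\<lambda>u. ennreal (\<phi> u) * G' u)"
  shows "iter_norm L r b q \<phi> G \<le> c * iter_norm L r b q \<phi> G'"
  unfolding iter_norm_def
proof (rule haar_norm_le[OF r])
  have [measurable]: "b \<in> borel_measurable (lebesgue_on (einterval 0 L))"
    by (rule regvar_measurable[OF b])
  have [measurable]: "(\<lambda>t. haar_norm q 0 (ereal t) F) \<in> borel_measurable (lebesgue_on S)" for S F
    by (intro borel_imp_lebesgue_on haar_norm_lower_measurable q)
  show "(\<lambda>t. ennreal (b t) * haar_norm q 0 (ereal t) (\<lambda>u. ennreal (\<phi> u) * G u)) \<in> borel_measurable (lebesgue_on (einterval 0 L))"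
    "(\<lambda>t. ennreal (b t) * haar_norm q 0 (ereal t) (\<lambda>u. ennreal (\<phi> u) * G' u)) \<in> borel_measurable (lebesgue_on (einterval 0 L))"
    by measurable
  fix t
  assume "t \<in> einterval 0 L"
  from mult_left_mono[OF le[OF this], of "ennreal (b t)"]
  show "ennreal (b t) * haar_norm q 0 (ereal t) (\<lambda>u. ennreal (\<phi> u) * G u)
     \<le> c * (ennreal (b t) * haar_norm q 0 (ereal t) (\<lambda>u. ennreal (\<phi> u) * G' u))"
    by (simp add: mult_ac)
qed simp

lemma equivalent_onI:
  assumes "0 < A" "0 < B" "\<And>x. x \<in> S \<Longrightarrow> F x \<le> ennreal A * G x" "\<And>x. x \<in> S \<Longrightarrow> G x \<le> ennreal B * F x"
  shows "equivalent_on S F G"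
  unfolding equivalent_on_def
proof (intro exI conjI ballI)
  \<comment> \<open>The maximum is taken because \<open>equivalent_on\<close> asks for the lower
    constant not to exceed the upper one.\<close>
  show "0 < 1 / B" "1 / B \<le> max A (1 / B)"
    using assms(2) by auto
  fix x
  assume x: "x \<in> S"
  have "ennreal (1 / B) * G x \<le> ennreal (1 / B) * (ennreal B * F x)"
    using assms(4)[OF x] by (rule mult_left_mono) simp
  also have "\<dots> = F x"
    using assms(2) by (simp flip: ennreal_mult mult.assoc)
  finally show "ennreal (1 / B) * G x \<le> F x" .
  have "F x \<le> ennreal A * G x"
    by (rule assms(3)[OF x])
  also have "\<dots> \<le> ennreal (max A (1 / B)) * G x"
    by (intro mult_right_mono ennreal_leI) auto
  finally show "F x \<le> ennreal (max A (1 / B)) * G x" .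
qed

text \<open>The range \<open>(0, t)\<close> contains \<open>(t/2, t)\<close>, so the average
  dominates \<open>g t\<close> pointwise. Conversely, Hardy's inequality holds on each
  \<open>(0, t)\<close> with one constant. The outer norm enters only through its monotonicity, so
  \<open>b\<close> may have any index.\<close>

lemma iter_norm_lower_average:
  assumes q: "0 < q" and r: "0 < r" and W: "0 < W" and b: "regvar L \<sigma> b"
    and \<phi>: "regvar L \<alpha> \<phi>" and \<psi>: "regvar L \<beta> \<psi>" and less: "\<alpha> < \<beta>"
  shows "equivalent_on {g. antimono g} (iter_norm L r b q \<phi>)
    (\<lambda>g. iter_norm L r b q \<phi> (\<lambda>u. inverse (ennreal (\<psi> u)) * haar_norm W 0 (ereal u) (\<lambda>v. ennreal (\<psi> v) * g v)))"
proof -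
  let ?H = "\<lambda>g u. inverse (ennreal (\<psi> u)) * haar_norm W 0 (ereal u) (\<lambda>v. ennreal (\<psi> v) * g v)"
  obtain A where A: "0 < A"
    "\<And>g t. antimono g \<Longrightarrow> 0 < t \<Longrightarrow> ereal t < L \<Longrightarrow>
       ennreal (\<psi> t) * g t \<le> ennreal A * haar_norm W (ereal (t / 2)) (ereal t) (\<lambda>w. ennreal (\<psi> w) * g w)"
    using regvar_antimono_le_haar_norm[OF W \<psi>] by blast
  obtain B where B: "0 < B"
    "\<And>g T. antimono g \<Longrightarrow> T \<le> L \<Longrightarrow>
       haar_norm q 0 T (\<lambda>u. ennreal (\<phi> u / \<psi> u) * haar_norm W 0 (ereal u) (\<lambda>v. ennreal (\<psi> v) * g v))
       \<le> ennreal B * haar_norm q 0 T (\<lambda>u. ennreal (\<phi> u) * g u)"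
    using haar_norm_antimono_Hardy_lower[OF q W \<phi> \<psi> less] by blast
  have le1: "g t \<le> ennreal A * ?H g t" if g: "antimono g" and t: "0 < t" "ereal t < L" for g t
  proof -
    have pos: "0 < \<psi> t"
      using regvar_pos[OF \<psi>] t by auto
    have "haar_norm W (ereal (t / 2)) (ereal t) (\<lambda>w. ennreal (\<psi> w) * g w) \<le> haar_norm W 0 (ereal t) (\<lambda>w. ennreal (\<psi> w) * g w)"
      using t by (intro haar_norm_subset[OF W] einterval_mono) auto
    then have "ennreal (\<psi> t) * g t \<le> ennreal A * haar_norm W 0 (ereal t) (\<lambda>w. ennreal (\<psi> w) * g w)"
      using A(2)[OF g t] by (meson mult_left_mono order_trans zero_le)
    then have "inverse (ennreal (\<psi> t)) * (ennreal (\<psi> t) * g t)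
       \<le> inverse (ennreal (\<psi> t)) * (ennreal A * haar_norm W 0 (ereal t) (\<lambda>w. ennreal (\<psi> w) * g w))"
      by (rule mult_left_mono) simp
    moreover have "inverse (ennreal (\<psi> t)) * ennreal (\<psi> t) = 1"
      using pos by (simp add: inverse_ennreal flip: ennreal_mult)
    ultimately show ?thesis
      by (simp add: mult.assoc[symmetric]) (simp add: mult_ac)
  qed
  have \<psi>_meas: "\<psi> \<in> borel_measurable (lebesgue_on S)" "\<phi> \<in> borel_measurable (lebesgue_on S)"
    if "S \<subseteq> einterval 0 L" for S
    using that measurable_subinterval regvar_measurable \<phi> \<psi> by blast+
  have H_meas [measurable]: "(\<lambda>u. haar_norm W 0 (ereal u) F) \<in> borel_measurable (lebesgue_on S)" for S F
    by (intro borel_imp_lebesgue_on haar_norm_lower_measurable W)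
  show ?thesis
  proof (rule equivalent_onI[OF A(1) B(1)])
    fix g :: "real \<Rightarrow> ennreal"
    assume "g \<in> {g. antimono g}"
    then have g: "antimono g"
      by simp
    show "iter_norm L r b q \<phi> g \<le> ennreal A * iter_norm L r b q \<phi> (?H g)"
    proof (rule iter_norm_le[OF q r b])
      fix t
      assume "t \<in> einterval 0 L"
      then have sub: "einterval 0 (ereal t) \<subseteq> einterval 0 L"
        by (intro einterval_mono) (auto simp: einterval_iff)
      note [measurable] = \<psi>_meas[OF sub]
      show "haar_norm q 0 (ereal t) (\<lambda>u. ennreal (\<phi> u) * g u) \<le> ennreal A * haar_norm q 0 (ereal t) (\<lambda>u. ennreal (\<phi> u) * ?H g u)"
      proof (rule haar_norm_le[OF q])
        fix u
        assume "u \<in> einterval 0 (ereal t)"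
        then have "0 < u" "ereal u < L"
          using sub by (auto simp: einterval_iff)
        from mult_left_mono[OF le1[OF g this], of "ennreal (\<phi> u)"]
        show "ennreal (\<phi> u) * g u \<le> ennreal A * (ennreal (\<phi> u) * ?H g u)"
          by (simp add: mult_ac)
      qed (auto intro: regvar_times_antimono_measurable[OF \<phi> g sub])
    qed
    show "iter_norm L r b q \<phi> (?H g) \<le> ennreal B * iter_norm L r b q \<phi> g"
    proof (rule iter_norm_le[OF q r b])
      fix t
      assume t: "t \<in> einterval 0 L"
      have "haar_norm q 0 (ereal t) (\<lambda>u. ennreal (\<phi> u) * ?H g u) =
        haar_norm q 0 (ereal t) (\<lambda>u. ennreal (\<phi> u / \<psi> u) * haar_norm W 0 (ereal u) (\<lambda>v. ennreal (\<psi> v) * g v))"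
      proof (rule haar_norm_cong)
        fix u
        assume "u \<in> einterval 0 (ereal t)"
        then have "0 < u" "ereal u < L"
          using t using less_trans[of "ereal u" "ereal t" L] by (auto simp: einterval_iff)
        then show "ennreal (\<phi> u) * ?H g u = ennreal (\<phi> u / \<psi> u) * haar_norm W 0 (ereal u) (\<lambda>v. ennreal (\<psi> v) * g v)"
          using regvar_pos[OF \<phi>, of u] regvar_pos[OF \<psi>, of u]
          by (simp add: divide_inverse inverse_ennreal ennreal_mult mult.assoc)
      qed
      then show "haar_norm q 0 (ereal t) (\<lambda>u. ennreal (\<phi> u) * ?H g u) \<le> ennreal B * haar_norm q 0 (ereal t) (\<lambda>u. ennreal (\<phi> u) * g u)"
        using B(2)[OF g, of "ereal t"] t by (simp add: einterval_iff less_imp_le)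
    qed
  qed
qed

text \<open>The average over \<open>(u, L)\<close> looks beyond the inner interval
  \<open>(0, t)\<close>. What it sees there is estimated in the outer norm with weight
  \<open>b * \<phi>\<close>; index 0 of \<open>b\<close> keeps the index of this weight at
  \<open>\<alpha>\<close>, above \<open>\<beta>\<close>.\<close>

lemma iter_norm_upper_average:
  assumes q: "0 < q" and r: "0 < r" and W: "0 < W" and b: "regvar L 0 b"
    and \<phi>: "regvar L \<alpha> \<phi>" and \<psi>: "regvar L \<beta> \<psi>" and less: "\<beta> < \<alpha>"
  shows "equivalent_on {g. antimono g} (iter_norm L r b q \<phi>)
    (\<lambda>g. iter_norm L r b q \<phi> (\<lambda>u. inverse (ennreal (\<psi> u)) * haar_norm W (ereal u) L (\<lambda>v. ennreal (\<psi> v) * g v)))"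
proof -
  let ?H = "\<lambda>g u. inverse (ennreal (\<psi> u)) * haar_norm W (ereal u) L (\<lambda>v. ennreal (\<psi> v) * g v)"
  have \<chi>: "regvar L (\<alpha> - \<beta>) (\<lambda>u. \<phi> u / \<psi> u)"
    by (rule regvar_divide[OF \<phi> \<psi>])
  have \<chi>0: "0 < \<alpha> - \<beta>"
    using less by simp
  have b\<phi>: "regvar L (0 + \<alpha>) (\<lambda>u. b u * \<phi> u)"
    by (rule regvar_mult[OF b \<phi>])
  have less': "\<beta> < 0 + \<alpha>"
    using less by simp
  \<comment> \<open>The additional power prepares Hardy's inequality over \<open>(0, u)\<close>,
    which afterwards returns the norm of \<open>\<phi>\<close> times the average. Any positive power
    would serve.\<close>
  have \<phi>1: "regvar L (1 + \<alpha>) (\<lambda>u. u powr 1 * \<phi> u)"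
    by (intro regvar_mult regvar_powr \<phi>)
  have H_meas [measurable]: "(\<lambda>u. haar_norm W (ereal u) T F) \<in> borel_measurable (lebesgue_on S)" for S F T
    using haar_norm_upper_measurable[OF W, of 1] by (intro borel_imp_lebesgue_on) simp
  have I_meas [measurable]: "(\<lambda>t. haar_norm q 0 (ereal t) F) \<in> borel_measurable (lebesgue_on S)" for S F
    by (intro borel_imp_lebesgue_on haar_norm_lower_measurable q)
  have weight_meas: "\<psi> \<in> borel_measurable (lebesgue_on S)" "\<phi> \<in> borel_measurable (lebesgue_on S)"
    "b \<in> borel_measurable (lebesgue_on S)"
    if "S \<subseteq> einterval 0 L" for S
    using that measurable_subinterval regvar_measurable \<phi> \<psi> b by blast+
  have sub: "einterval 0 (ereal t) \<subseteq> einterval 0 L" if "t \<in> einterval 0 L" for t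
    using that by (intro einterval_mono) (auto simp: einterval_iff)
  have \<phi>H: "ennreal (\<phi> u) * ?H g u = ennreal (\<phi> u / \<psi> u) * haar_norm W (ereal u) L (\<lambda>v. ennreal (\<psi> v) * g v)"
    if "u \<in> einterval 0 L" for u g
    using that regvar_pos[OF \<phi>, of u] regvar_pos[OF \<psi>, of u]
    by (simp add: einterval_iff divide_inverse inverse_ennreal ennreal_mult mult.assoc)

  obtain A where A: "0 < A"
    "\<And>g t. antimono g \<Longrightarrow> 0 < t \<Longrightarrow> ereal t < L \<Longrightarrow>
       ennreal (\<psi> t) * g t \<le> ennreal A * haar_norm W (ereal (t / 2)) (ereal t) (\<lambda>w. ennreal (\<psi> w) * g w)"
    using regvar_antimono_le_haar_norm[OF W \<psi>] by blast
  obtain A\<psi> where A\<psi>: "0 < A\<psi>"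
    "\<And>x y. 0 < x \<Longrightarrow> x \<le> y \<Longrightarrow> ereal y < L \<Longrightarrow> \<psi> x \<le> A\<psi> * (y / x) powr (1 - \<beta>) * \<psi> y"
    using regvar_lower_bound[OF \<psi> zero_less_one] by blast
  obtain A\<phi> where A\<phi>: "0 < A\<phi>"
    "\<And>x y. 0 < x \<Longrightarrow> x \<le> y \<Longrightarrow> ereal y < L \<Longrightarrow> \<phi> y \<le> A\<phi> * (y / x) powr (\<alpha> + 1) * \<phi> x"
    using regvar_upper_bound[OF \<phi> zero_less_one] by blast
  obtain B where B: "0 < B"
    "\<And>g t. antimono g \<Longrightarrow> 0 < t \<Longrightarrow> ereal t < L \<Longrightarrow> ennreal (t powr 1 * \<phi> t) * g t
       \<le> ennreal B * haar_norm q (ereal (t / 2)) (ereal t) (\<lambda>w. ennreal (w powr 1 * \<phi> w) * g w)"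
    using regvar_antimono_le_haar_norm[OF q \<phi>1] by blast
  obtain B' where B': "0 < B'"
    "\<And>g t. antimono g \<Longrightarrow> 0 < t \<Longrightarrow> ereal t < L \<Longrightarrow> ennreal (\<phi> t) * g t
       \<le> ennreal B' * haar_norm q (ereal (t / 2)) (ereal t) (\<lambda>w. ennreal (\<phi> w) * g w)"
    using regvar_antimono_le_haar_norm[OF q \<phi>] by blast
  obtain H where H: "0 < H"
    "\<And>T G. G \<in> borel_measurable (lebesgue_on (einterval 0 T)) \<Longrightarrow>
      haar_norm q 0 T (\<lambda>u. ennreal (u powr - 1) * haar_norm q 0 (ereal u) (\<lambda>w. ennreal (w powr 1) * G w))
      \<le> ennreal H * haar_norm q 0 T G"
    using haar_norm_Hardy_lower[OF q zero_less_one] by blast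
  obtain D where D: "0 < D"
    "\<And>g T. antimono g \<Longrightarrow> T \<le> L \<Longrightarrow>
       haar_norm q 0 T (\<lambda>u. ennreal (\<phi> u / \<psi> u) * haar_norm W (ereal u) T (\<lambda>v. ennreal (\<psi> v) * g v))
       \<le> ennreal D * haar_norm q 0 T (\<lambda>u. ennreal (\<phi> u) * g u)"
    using haar_norm_antimono_Hardy_upper[OF q W \<phi> \<psi> less] by blast
  obtain D' where D': "0 < D'"
    "\<And>g T. antimono g \<Longrightarrow> T \<le> L \<Longrightarrow>
       haar_norm r 0 T (\<lambda>u. ennreal (b u * \<phi> u / \<psi> u) * haar_norm W (ereal u) T (\<lambda>v. ennreal (\<psi> v) * g v))
       \<le> ennreal D' * haar_norm r 0 T (\<lambda>u. ennreal (b u * \<phi> u) * g u)"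
    using haar_norm_antimono_Hardy_upper[OF r W b\<phi> \<psi> less'] by blast
  obtain E where E: "0 < E"
    "\<And>t. 0 < t \<Longrightarrow> ereal t < L \<Longrightarrow> haar_norm q 0 (ereal t) (\<lambda>u. ennreal (\<phi> u / \<psi> u)) \<le> ennreal (E * (\<phi> t / \<psi> t))"
    using haar_norm_regvar_le[OF q \<chi> \<chi>0] by blast
  obtain S where S: "0 < S"
    "\<And>x t y G. 0 \<le> x \<Longrightarrow> x \<le> ereal t \<Longrightarrow> ereal t \<le> y \<Longrightarrow> G \<in> borel_measurable (lebesgue_on (einterval x y)) \<Longrightarrow>
      haar_norm W x y G \<le> ennreal S * (haar_norm W x (ereal t) G + haar_norm W (ereal t) y G)"
    using haar_norm_split_le[OF W] by blast
  obtain P where P: "0 < P"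
    "\<And>x y G H. 0 \<le> x \<Longrightarrow> G \<in> borel_measurable (lebesgue_on (einterval x y)) \<Longrightarrow>
      H \<in> borel_measurable (lebesgue_on (einterval x y)) \<Longrightarrow>
      haar_norm q x y (\<lambda>u. G u + H u) \<le> ennreal P * (haar_norm q x y G + haar_norm q x y H)"
    using haar_norm_add_le[OF q] by blast
  obtain P' where P': "0 < P'"
    "\<And>x y G H. 0 \<le> x \<Longrightarrow> G \<in> borel_measurable (lebesgue_on (einterval x y)) \<Longrightarrow>
      H \<in> borel_measurable (lebesgue_on (einterval x y)) \<Longrightarrow>
      haar_norm r x y (\<lambda>u. G u + H u) \<le> ennreal P' * (haar_norm r x y G + haar_norm r x y H)"
    using haar_norm_add_le[OF r] by blast

  \<comment> \<open>\<open>A\<close> comes from the pointwise bound at \<open>2 * v\<close>, whose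
    interval \<open>(v, 2 * v)\<close> lies in \<open>(v, L)\<close>. The rest compares
    \<open>\<psi> v\<close> with \<open>\<psi> (2 * v)\<close>, with
    \<open>\<epsilon> = 1\<close>.\<close>
  define c1 where "c1 = A * A\<psi> * 2 powr (1 - \<beta>)"
  have c1: "0 < c1"
    using A(1) A\<psi>(1) by (simp add: c1_def)
  have le1: "g (2 * v) \<le> ennreal c1 * ?H g v" if g: "antimono g" and v: "0 < v" "ereal (2 * v) < L" for g v
  proof -
    have vL: "ereal v < L"
      using v less_trans[of "ereal v" "ereal (2 * v)" L] by simp
    have pos: "0 < \<psi> v"
      using regvar_pos[OF \<psi> v(1) vL] .
    have "\<psi> v \<le> A\<psi> * 2 powr (1 - \<beta>) * \<psi> (2 * v)"
      using A\<psi>(2)[of v "2 * v"] v by simp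
    then have "ennreal (\<psi> v) * g (2 * v) \<le> ennreal (A\<psi> * 2 powr (1 - \<beta>) * \<psi> (2 * v)) * g (2 * v)"
      by (intro mult_right_mono ennreal_leI) auto
    also have "\<dots> = ennreal (A\<psi> * 2 powr (1 - \<beta>)) * (ennreal (\<psi> (2 * v)) * g (2 * v))"
      using A\<psi>(1) by (simp add: ennreal_mult' mult.assoc)
    also have "\<dots> \<le> ennreal (A\<psi> * 2 powr (1 - \<beta>)) * (ennreal A * haar_norm W (ereal v) (ereal (2 * v)) (\<lambda>w. ennreal (\<psi> w) * g w))"
      using A(2)[OF g, of "2 * v"] v by (intro mult_left_mono) auto
    also have "\<dots> \<le> ennreal (A\<psi> * 2 powr (1 - \<beta>)) * (ennreal A * haar_norm W (ereal v) L (\<lambda>w. ennreal (\<psi> w) * g w))"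
      using v by (intro mult_left_mono haar_norm_subset[OF W] einterval_mono) auto
    also have "\<dots> = ennreal c1 * haar_norm W (ereal v) L (\<lambda>w. ennreal (\<psi> w) * g w)"
      using A(1) A\<psi>(1) by (simp add: c1_def ennreal_mult mult_ac)
    finally have "inverse (ennreal (\<psi> v)) * (ennreal (\<psi> v) * g (2 * v)) \<le>
        inverse (ennreal (\<psi> v)) * (ennreal c1 * haar_norm W (ereal v) L (\<lambda>w. ennreal (\<psi> w) * g w))"
      by (rule mult_left_mono) simp
    moreover have "inverse (ennreal (\<psi> v)) * (ennreal (\<psi> v) * g (2 * v)) = g (2 * v)"
      using pos by (simp add: inverse_ennreal flip: ennreal_mult mult.assoc)
    ultimately show ?thesis
      by (simp add: mult_ac)
  qed

  \<comment> \<open>For \<open>L = 1\<close> the average at \<open>v\<close> tends to 0 as \<open>v\<close> tends to \<open>L\<close> and cannot dominate \<open>g v\<close>, only \<open>g (2 * v)\<close>;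
    the dilation is undone inside a Hardy integral over \<open>(0, u)\<close>.\<close>
  define c2 where "c2 = A\<phi> * 2 powr (\<alpha> + 1) * 2 * B * c1"
  have c2: "0 < c2"
    using A\<phi>(1) B(1) c1 by (simp add: c2_def)
  have collect: "ennreal (k * m) * (ennreal x * (ennreal y * X)) = ennreal (k * x * y) * (ennreal m * X)"
    if "0 \<le> k" "0 \<le> m" "0 \<le> x" "0 \<le> y" for k m x y :: real and X
    using that by (simp add: ennreal_mult mult_ac)
  have le2: "ennreal (\<phi> u) * g u \<le> ennreal c2 * (ennreal (u powr - 1) * haar_norm q 0 (ereal u) (\<lambda>w. ennreal (w powr 1) * (ennreal (\<phi> w) * ?H g w)))"
    if g: "antimono g" and u: "0 < u" "ereal u < L" for g u
  proof -
    have uL: "ereal (u / 2) < L"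
      using u less_trans[of "ereal (u / 2)" "ereal u" L] by simp
    have pos: "0 < \<phi> (u / 2)"
      using regvar_pos[OF \<phi> _ uL] u by simp
    have sub': "einterval (ereal (u / 2 / 2)) (ereal (u / 2)) \<subseteq> einterval 0 L"
      using u uL by (intro einterval_mono) (auto simp: less_imp_le)
    \<comment> \<open>The pointwise bound is applied to this function at \<open>u / 2\<close>, where
      its value is \<open>g u\<close>. On \<open>(u/4, u/2)\<close> the points \<open>2 * w\<close>
      stay below \<open>u\<close>, hence below \<open>L\<close>, as the comparison of
      \<open>g (2 * w)\<close> with the average at \<open>w\<close> requires.\<close>
    have g': "antimono (\<lambda>w. g (2 * w))"
      using g by (simp add: antimono_def)
    note [measurable] = weight_meas[OF sub']
    have m: "(\<lambda>w. ennreal (w powr 1) * (ennreal (\<phi> w) * ?H g w))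
        \<in> borel_measurable (lebesgue_on (einterval (ereal (u / 2 / 2)) (ereal (u / 2))))"
      by measurable
    have "\<phi> u \<le> A\<phi> * 2 powr (\<alpha> + 1) * \<phi> (u / 2)"
      using A\<phi>(2)[of "u / 2" u] u by simp
    also have "\<dots> = (A\<phi> * 2 powr (\<alpha> + 1) * 2 * u powr - 1) * ((u / 2) powr 1 * \<phi> (u / 2))"
      using u by (simp add: powr_minus)
    finally have "ennreal (\<phi> u) * g u \<le> ennreal ((A\<phi> * 2 powr (\<alpha> + 1) * 2 * u powr - 1) * ((u / 2) powr 1 * \<phi> (u / 2))) * g u"
      by (intro mult_right_mono ennreal_leI) auto
    also have "\<dots> = ennreal (A\<phi> * 2 powr (\<alpha> + 1) * 2 * u powr - 1) * (ennreal ((u / 2) powr 1 * \<phi> (u / 2)) * g (2 * (u / 2)))"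
      using A\<phi>(1) pos by (subst ennreal_mult) (auto simp: mult.assoc)
    also have "\<dots> \<le> ennreal (A\<phi> * 2 powr (\<alpha> + 1) * 2 * u powr - 1) *
      (ennreal B * haar_norm q (ereal (u / 2 / 2)) (ereal (u / 2)) (\<lambda>w. ennreal (w powr 1 * \<phi> w) * g (2 * w)))"
      using B(2)[OF g', of "u / 2"] u uL by (intro mult_left_mono) auto
    also have "\<dots> \<le> ennreal (A\<phi> * 2 powr (\<alpha> + 1) * 2 * u powr - 1) *
      (ennreal B * (ennreal c1 * haar_norm q (ereal (u / 2 / 2)) (ereal (u / 2)) (\<lambda>w. ennreal (w powr 1) * (ennreal (\<phi> w) * ?H g w))))"
    proof (intro mult_left_mono haar_norm_le[OF q _ regvar_times_antimono_measurable[OF \<phi>1 g' sub'] m])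
      fix w
      assume "w \<in> einterval (ereal (u / 2 / 2)) (ereal (u / 2))"
      then have w: "0 < w" "2 * w < u"
        using u by auto
      then have "ereal (2 * w) < L"
        using u less_trans[of "ereal (2 * w)" "ereal u" L] by simp
      from mult_left_mono[OF le1[OF g w(1) this], of "ennreal (w powr 1 * \<phi> w)"]
      show "ennreal (w powr 1 * \<phi> w) * g (2 * w) \<le> ennreal c1 * (ennreal (w powr 1) * (ennreal (\<phi> w) * ?H g w))"
        by (simp add: ennreal_mult' mult_ac)
    qed (use u in auto)
    also have "\<dots> \<le> ennreal (A\<phi> * 2 powr (\<alpha> + 1) * 2 * u powr - 1) *
      (ennreal B * (ennreal c1 * haar_norm q 0 (ereal u) (\<lambda>w. ennreal (w powr 1) * (ennreal (\<phi> w) * ?H g w))))"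
      using u by (intro mult_left_mono haar_norm_subset[OF q] einterval_mono) auto
    also have "\<dots> = ennreal c2 * (ennreal (u powr - 1) * haar_norm q 0 (ereal u) (\<lambda>w. ennreal (w powr 1) * (ennreal (\<phi> w) * ?H g w)))"
      unfolding c2_def by (rule collect) (use A\<phi>(1) B(1) c1 in auto)
    finally show ?thesis .
  qed

  define c3 where "c3 = S * P * (D + E)"
  have c3: "0 < c3"
    using S(1) P(1) D(1) E(1) by (simp add: c3_def)
  \<comment> \<open>The norm over \<open>(t, L)\<close> does not depend on \<open>u\<close> and
    leaves the inner norm as a factor. It is multiplied by the norm of
    \<open>\<phi> / \<psi>\<close> over \<open>(0, t)\<close>, which the positive index
    \<open>\<alpha> - \<beta>\<close> bounds by a multiple of the value at \<open>t\<close>. The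
    part over \<open>(u, t)\<close> is Hardy's inequality with \<open>T = t\<close>.\<close>
  have le3: "haar_norm q 0 (ereal t) (\<lambda>u. ennreal (\<phi> u) * ?H g u)
      \<le> ennreal c3 * (haar_norm q 0 (ereal t) (\<lambda>u. ennreal (\<phi> u) * g u)
          + ennreal (\<phi> t / \<psi> t) * haar_norm W (ereal t) L (\<lambda>v. ennreal (\<psi> v) * g v))"
    if g: "antimono g" and t: "t \<in> einterval 0 L" for g t
  proof -
    have t': "0 < t" "ereal t < L"
      using t by (auto simp: einterval_iff)
    note [measurable] = weight_meas[OF sub[OF t]]
    define Z where "Z = haar_norm W (ereal t) L (\<lambda>v. ennreal (\<psi> v) * g v)"
    define I where "I = haar_norm q 0 (ereal t) (\<lambda>u. ennreal (\<phi> u) * g u)"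
    let ?X = "\<lambda>u. ennreal (\<phi> u / \<psi> u) * haar_norm W (ereal u) (ereal t) (\<lambda>v. ennreal (\<psi> v) * g v)"
    let ?Y = "\<lambda>u. ennreal (\<phi> u / \<psi> u) * Z"
    have pos: "0 < \<phi> t" "0 < \<psi> t"
      using regvar_pos[OF \<phi> t'] regvar_pos[OF \<psi> t'] .
    have "haar_norm q 0 (ereal t) (\<lambda>u. ennreal (\<phi> u) * ?H g u) \<le> ennreal S * haar_norm q 0 (ereal t) (\<lambda>u. ?X u + ?Y u)"
    proof (rule haar_norm_le[OF q])
      fix u
      assume u: "u \<in> einterval 0 (ereal t)"
      then have uL: "u \<in> einterval 0 L"
        using sub[OF t] by auto
      have "einterval (ereal u) L \<subseteq> einterval 0 L"
        using u by (intro einterval_mono) (auto simp: einterval_iff)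
      then have "haar_norm W (ereal u) L (\<lambda>v. ennreal (\<psi> v) * g v) \<le>
         ennreal S * (haar_norm W (ereal u) (ereal t) (\<lambda>v. ennreal (\<psi> v) * g v) + Z)"
        unfolding Z_def using u t'
        by (intro S(2) regvar_times_antimono_measurable[OF \<psi> g]) (auto simp: einterval_iff)
      then have "ennreal (\<phi> u / \<psi> u) * haar_norm W (ereal u) L (\<lambda>v. ennreal (\<psi> v) * g v) \<le>
         ennreal (\<phi> u / \<psi> u) * (ennreal S * (haar_norm W (ereal u) (ereal t) (\<lambda>v. ennreal (\<psi> v) * g v) + Z))"
        by (rule mult_left_mono) simp
      then show "ennreal (\<phi> u) * ?H g u \<le> ennreal S * (?X u + ?Y u)"
        unfolding \<phi>H[OF uL] by (simp add: distrib_left mult_ac)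
    qed auto
    also have "\<dots> \<le> ennreal S * (ennreal P * (haar_norm q 0 (ereal t) ?X + haar_norm q 0 (ereal t) ?Y))"
      by (intro mult_left_mono P(2)) auto
    also have "\<dots> \<le> ennreal S * (ennreal P * (ennreal (D + E) * I + ennreal (D + E) * (ennreal (\<phi> t / \<psi> t) * Z)))"
    proof (intro mult_left_mono add_mono)
      have "haar_norm q 0 (ereal t) ?X \<le> ennreal D * I"
        unfolding I_def using t' by (intro D(2)[OF g]) (simp add: less_imp_le)
      also have "\<dots> \<le> ennreal (D + E) * I"
        using E(1) by (intro mult_right_mono ennreal_leI) auto
      finally show "haar_norm q 0 (ereal t) ?X \<le> ennreal (D + E) * I" .
      have "haar_norm q 0 (ereal t) ?Y \<le> Z * haar_norm q 0 (ereal t) (\<lambda>u. ennreal (\<phi> u / \<psi> u))"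
        by (rule haar_norm_le[OF q]) (auto simp: mult.commute)
      also have "\<dots> \<le> Z * ennreal (E * (\<phi> t / \<psi> t))"
        by (intro mult_left_mono E(2) t') simp
      also have "\<dots> \<le> Z * ennreal ((D + E) * (\<phi> t / \<psi> t))"
        using D(1) pos by (intro mult_left_mono ennreal_leI mult_right_mono) auto
      also have "\<dots> = ennreal (D + E) * (ennreal (\<phi> t / \<psi> t) * Z)"
        using D(1) E(1) pos by (subst ennreal_mult) (auto simp: mult_ac)
      finally show "haar_norm q 0 (ereal t) ?Y \<le> ennreal (D + E) * (ennreal (\<phi> t / \<psi> t) * Z)" .
    qed auto
    also have "\<dots> = ennreal c3 * (I + ennreal (\<phi> t / \<psi> t) * Z)"
      using S(1) P(1) D(1) E(1)
      by (simp add: c3_def ennreal_mult distrib_left[where 'a = ennreal] mult.assoc del: ennreal_plus)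
    finally show ?thesis
      by (simp only: I_def Z_def)
  qed

  show ?thesis
  proof (rule equivalent_onI)
    fix g :: "real \<Rightarrow> ennreal"
    assume "g \<in> {g. antimono g}"
    then have g: "antimono g"
      by simp
    show "iter_norm L r b q \<phi> g \<le> ennreal (c2 * H) * iter_norm L r b q \<phi> (?H g)"
    proof (rule iter_norm_le[OF q r b])
      fix t
      assume t: "t \<in> einterval 0 L"
      note [measurable] = weight_meas[OF sub[OF t]]
      have "haar_norm q 0 (ereal t) (\<lambda>u. ennreal (\<phi> u) * g u) \<le> ennreal c2 * haar_norm q 0 (ereal t)
         (\<lambda>u. ennreal (u powr - 1) * haar_norm q 0 (ereal u) (\<lambda>w. ennreal (w powr 1) * (ennreal (\<phi> w) * ?H g w)))"
      proof (rule haar_norm_le[OF q _ regvar_times_antimono_measurable[OF \<phi> g sub[OF t]]])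
        fix u
        assume "u \<in> einterval 0 (ereal t)"
        then have "0 < u" "ereal u < L"
          using sub[OF t] by (auto simp: einterval_iff)
        then show "ennreal (\<phi> u) * g u \<le> ennreal c2 * (ennreal (u powr - 1) *
           haar_norm q 0 (ereal u) (\<lambda>w. ennreal (w powr 1) * (ennreal (\<phi> w) * ?H g w)))"
          by (rule le2[OF g])
      qed auto
      also have "\<dots> \<le> ennreal c2 * (ennreal H * haar_norm q 0 (ereal t) (\<lambda>w. ennreal (\<phi> w) * ?H g w))"
        by (intro mult_left_mono H(2)) auto
      finally show "haar_norm q 0 (ereal t) (\<lambda>u. ennreal (\<phi> u) * g u)
         \<le> ennreal (c2 * H) * haar_norm q 0 (ereal t) (\<lambda>w. ennreal (\<phi> w) * ?H g w)"
        using c2 H(1) by (simp add: ennreal_mult mult.assoc)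
    qed
    note [measurable] = weight_meas[OF order_refl]
    let ?I = "\<lambda>t. ennreal (b t) * haar_norm q 0 (ereal t) (\<lambda>u. ennreal (\<phi> u) * g u)"
    let ?Z = "\<lambda>t. ennreal (b t * \<phi> t / \<psi> t) * haar_norm W (ereal t) L (\<lambda>v. ennreal (\<psi> v) * g v)"
    have bpos: "0 < b t" if "t \<in> einterval 0 L" for t
      using regvar_pos[OF b] that by (simp add: einterval_iff)
    have "iter_norm L r b q \<phi> (?H g) \<le> ennreal c3 * haar_norm r 0 L (\<lambda>t. ?I t + ?Z t)"
      unfolding iter_norm_def
    proof (rule haar_norm_le[OF r])
      fix t
      assume t: "t \<in> einterval 0 L"
      have "ennreal (b t * \<phi> t / \<psi> t) = ennreal (b t) * ennreal (\<phi> t / \<psi> t)"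
        using bpos[OF t] by (simp flip: ennreal_mult')
      with mult_left_mono[OF le3[OF g t], of "ennreal (b t)"]
      show "ennreal (b t) * haar_norm q 0 (ereal t) (\<lambda>u. ennreal (\<phi> u) * ?H g u) \<le> ennreal c3 * (?I t + ?Z t)"
        by (simp add: distrib_left mult_ac)
    qed auto
    also have "\<dots> \<le> ennreal c3 * (ennreal P' * (haar_norm r 0 L ?I + haar_norm r 0 L ?Z))"
      by (intro mult_left_mono P'(2)) auto
    also have "\<dots> \<le> ennreal c3 * (ennreal P' * (haar_norm r 0 L ?I + ennreal (D' * B') * haar_norm r 0 L ?I))"
    proof (intro mult_left_mono add_mono order_refl)
      \<comment> \<open>Hardy's inequality with exponent \<open>r\<close> on all of
        \<open>(0, L)\<close> turns the tail into \<open>b t * \<phi> t * g t\<close>; the dyadic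
        bound then returns \<open>\<phi> t * g t\<close> to the inner norm over
        \<open>(0, t)\<close>.\<close>
      have "haar_norm r 0 L ?Z \<le> ennreal D' * haar_norm r 0 L (\<lambda>u. ennreal (b u * \<phi> u) * g u)"
        by (rule D'(2)[OF g order_refl])
      also have "\<dots> \<le> ennreal D' * (ennreal B' * haar_norm r 0 L ?I)"
      proof (intro mult_left_mono haar_norm_le[OF r _ regvar_times_antimono_measurable[OF b\<phi> g order_refl]])
        fix t
        assume t: "t \<in> einterval 0 L"
        then have t': "0 < t" "ereal t < L"
          by (auto simp: einterval_iff)
        have "haar_norm q (ereal (t / 2)) (ereal t) (\<lambda>w. ennreal (\<phi> w) * g w) \<le> haar_norm q 0 (ereal t) (\<lambda>w. ennreal (\<phi> w) * g w)"
          using t' by (intro haar_norm_subset[OF q] einterval_mono) auto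
        then have "ennreal B' * haar_norm q (ereal (t / 2)) (ereal t) (\<lambda>w. ennreal (\<phi> w) * g w)
           \<le> ennreal B' * haar_norm q 0 (ereal t) (\<lambda>w. ennreal (\<phi> w) * g w)"
          by (rule mult_left_mono) simp
        with B'(2)[OF g t'] have "ennreal (\<phi> t) * g t \<le> ennreal B' * haar_norm q 0 (ereal t) (\<lambda>w. ennreal (\<phi> w) * g w)"
          by (rule order_trans)
        note le = mult_left_mono[OF this, of "ennreal (b t)"]
        have b\<phi>_eq: "ennreal (b t * \<phi> t) = ennreal (b t) * ennreal (\<phi> t)"
          using bpos[OF t] by (simp add: ennreal_mult')
        show "ennreal (b t * \<phi> t) * g t \<le> ennreal B' * ?I t"
          unfolding b\<phi>_eq using le by (simp add: mult_ac)
      qed auto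
      also have "\<dots> = ennreal (D' * B') * haar_norm r 0 L ?I"
        using D'(1) B'(1) by (simp add: ennreal_mult mult.assoc)
      finally show "haar_norm r 0 L ?Z \<le> ennreal (D' * B') * haar_norm r 0 L ?I" .
    qed auto
    also have "\<dots> = ennreal (c3 * P' * (1 + D' * B')) * iter_norm L r b q \<phi> g"
    proof -
      have "ennreal (1 + D' * B') = 1 + ennreal (D' * B')"
        using D'(1) B'(1) by (subst ennreal_plus) auto
      then show ?thesis
        using c3 P'(1) D'(1) B'(1)
        by (simp add: ennreal_mult iter_norm_def mult.assoc distrib_right[where 'a = ennreal] del: ennreal_plus)
    qed
    finally show "iter_norm L r b q \<phi> (?H g) \<le> ennreal (c3 * P' * (1 + D' * B')) * iter_norm L r b q \<phi> g" .
  qed (use c2 H(1) c3 P'(1) D'(1) B'(1) in \<open>auto intro!: mult_pos_pos add_pos_pos\<close>)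
qed

section \<open>From exponents to indices of weights\<close>

lemma recip_strict_antimono:
  assumes "0 < x" "x < y"
  shows "recip y < recip x"
proof -
  obtain s where s: "x = ereal s" "0 < s"
    using assms by (cases x) auto
  show ?thesis
  proof (cases y)
    case (real t)
    then show ?thesis
      using assms s by (simp add: recip_ereal divide_strict_left_mono)
  \<comment> \<open>The case \<open>y = \<infinity>\<close>, where the reciprocal is 0, is the one
    needed for \<open>p = \<infinity>\<close> in (i) and \<open>V = \<infinity>\<close> in
    (ii).\<close>
  qed (use assms s in \<open>auto simp: recip_ereal\<close>)
qed

lemma powr_SV_regvar:
  assumes "d \<in> SV L"
  shows "regvar L k (\<lambda>u. u powr k * d u)"
  using regvar_mult[OF regvar_powr SV_regvar[OF assms], of k] by simp

text \<open>With \<open>h = rearrangement L\<close> this carries an equivalence over all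
  non-increasing functions to one over \<open>f\<close> with the same constants.\<close>

lemma equivalent_on_comp:
  "equivalent_on S F G \<Longrightarrow> (\<And>x. x \<in> T \<Longrightarrow> h x \<in> S) \<Longrightarrow> equivalent_on T (\<lambda>x. F (h x)) (\<lambda>x. G (h x))"
  unfolding equivalent_on_def by meson

theorem theorem49:
  fixes L p r q U V W :: ereal and a b d :: "real \<Rightarrow> real"
  assumes "L \<in> {1, \<infinity>}"
    and "0 < p" and "0 < r" and "0 < q"
    and "a \<in> SV L" and "b \<in> SV L"
    and "nontrivial_space L (L_space L p r b q a)"
    and "d \<in> SV L"
    and "0 < U" and "U < \<infinity>" and "0 < V" and "0 < W"
  shows "(U < p \<longrightarrow>
           equivalent_on (measurable_funs L)
             (\<lambda>f. L_norm L p r b q a f)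
             (\<lambda>f. B_norm L p r b q a (H_lower L U W d f)))
       \<and> (p < V \<longrightarrow>
           equivalent_on (measurable_funs L)
             (\<lambda>f. L_norm L p r b q a f)
             (\<lambda>f. B_norm L p r b q a (H_upper L V W d f)))"
proof (intro conjI impI)
  have H_eq: "H_lower L U W d f = (\<lambda>u. inverse (ennreal (u powr recip U * d u)) *
      haar_norm W 0 (ereal u) (\<lambda>v. ennreal (v powr recip U * d v) * rearrangement L f v))"
    "H_upper L V W d f = (\<lambda>u. inverse (ennreal (u powr recip V * d u)) *
      haar_norm W (ereal u) L (\<lambda>v. ennreal (v powr recip V * d v) * rearrangement L f v))" for f
    by (simp_all only: H_lower_def H_upper_def haar_norm_weight_eq fun_eq_iff simp_thms)
  \<comment> \<open>These equations turn both sides into \<open>iter_norm\<close> with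
    \<open>\<phi> u = u powr recip p * a u\<close>, of index \<open>recip p\<close>. The average has
    weight \<open>u powr recip U * d u\<close> or \<open>u powr recip V * d u\<close>, so the
    conditions on \<open>p\<close> become strict inequalities between indices.\<close>
  note eqs = L_norm_def B_norm_eq_iter_norm H_eq
  {
    assume "U < p"
    then have "recip p < recip U"
      using assms by (intro recip_strict_antimono)
    note iter_norm_lower_average[OF \<open>0 < q\<close> \<open>0 < r\<close> \<open>0 < W\<close> SV_regvar[OF \<open>b \<in> SV L\<close>]
        powr_SV_regvar[OF \<open>a \<in> SV L\<close>] powr_SV_regvar[OF \<open>d \<in> SV L\<close>] this]
    then show "equivalent_on (measurable_funs L)
             (\<lambda>f. L_norm L p r b q a f)
             (\<lambda>f. B_norm L p r b q a (H_lower L U W d f))"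
      unfolding eqs by (rule equivalent_on_comp) (simp add: antimono_rearrangement)
  }
  {
    assume "p < V"
    then have "recip V < recip p"
      using assms by (intro recip_strict_antimono)
    note iter_norm_upper_average[OF \<open>0 < q\<close> \<open>0 < r\<close> \<open>0 < W\<close> SV_regvar[OF \<open>b \<in> SV L\<close>]
        powr_SV_regvar[OF \<open>a \<in> SV L\<close>] powr_SV_regvar[OF \<open>d \<in> SV L\<close>] this]
    then show "equivalent_on (measurable_funs L)
             (\<lambda>f. L_norm L p r b q a f)
             (\<lambda>f. B_norm L p r b q a (H_upper L V W d f))"
      unfolding eqs by (rule equivalent_on_comp) (simp add: antimono_rearrangement)
  }
qed

end
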